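(* Let $A_1,\ldots,A_n$ ($n\ge 1$) be $m\times m$ real or complex matrices or hermitian quaternionic matrices, and form the polynomial $$P(x_1,\ldots,x_n)=\det\Bigl(\sum_{i=1}^n x_iA_i\Bigr)$$ in the variables $\mathbf{x}=(x_1,\ldots,x_n)$, where in the quaternionic case $\det$ denotes the Moore determinant. Assume further that there exists a linear combination of $A_1,\ldots,A_n$ that has rank $m$ (so that $P\not\equiv 0$). (a) If $A_1,\ldots,A_n$ are real symmetric positive-semidefinite matrices, then $P^{-\beta}$ is completely monotone on $(0,\infty)^n$ for $\beta=0,\frac12,1,\frac32,\ldots$ and for all real $\beta\ge (m-1)/2$. (b) If $A_1,\ldots,A_n$ are complex hermitian positive-semidefinite matrices, then $P^{-\beta}$ is completely monotone on $(0,\infty)^n$ for $\beta=0,1,2,3,\ldots$ and for all real $\beta\ge m-1$. (c) If $A_1,\ldots,A_n$ are quaternionic hermitian positive-semidefinite matrices, then $P^{-\beta}$ is completely monotone on $(0,\infty)^n$ for $\beta=0,2,4,6,\ldots$ and for all real $\beta\ge 2m-2$.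
   Context: A $C^\infty$ function $f$ on $(0,\infty)^n$ is completely monotone if $(-1)^k\,\partial^k f/\partial x_{i_1}\cdots\partial x_{i_k}\ge 0$ everywhere on $(0,\infty)^n$ for all $k\ge 0$ and all indices $i_1,\ldots,i_k$. Quaternionic conventions: $\mathbb{H}$ denotes the real quaternions; for $M\in\mathbb{H}^{m\times m}$, $M^*$ is the conjugate transpose, $M$ is hermitian if $M=M^*$, and a hermitian $M$ is positive-semidefinite if $v^*Mv\ge 0$ for all $v\in\mathbb{H}^m$. The rank of a quaternionic matrix is its left row rank (= right column rank). In the quaternionic case $x_1,\ldots,x_n$ are real variables and linear combinations are taken with real coefficients. Moore determinant: write $M=A+Bj$ with $A,B\in\mathbb{C}^{m\times m}$, put $\Psi(M)=\begin{pmatrix}A&B\\-\bar B&\bar A\end{pmatrix}$ and $J=\begin{pmatrix}0&I_m\\-I_m&0\end{pmatrix}$. For hermitian $M$ the matrix $J\Psi(M)$ is antisymmetric, and the Moore determinant of $M$ is $\mathrm{pf}(J\Psi(M))$, where the pfaffian $\mathrm{pf}$ is the polynomial on antisymmetric $2m\times 2m$ complex matrices uniquely determined by $(\mathrm{pf}\,Y)^2=\det Y$ and $\mathrm{pf}\,J=1$. It is real-valued. *)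

theory Defs
  imports "HOL-Analysis.Analysis" "HOL-Computational_Algebra.Polynomial"
begin

section \<open>Complete monotonicity\<close>

definition pos_orthant :: "(real ^ 'n) set" where
  "pos_orthant = {x. \<forall>i. 0 < x $ i}"

definition partial :: "'n \<Rightarrow> (real ^ 'n \<Rightarrow> real) \<Rightarrow> real ^ 'n \<Rightarrow> real" where
  "partial i f x = deriv (\<lambda>t. f (x + t *\<^sub>R axis i 1)) 0"

fun iter_partial :: "'n list \<Rightarrow> (real ^ 'n \<Rightarrow> real) \<Rightarrow> real ^ 'n \<Rightarrow> real" where
  "iter_partial [] f = f"
| "iter_partial (i # is) f = partial i (iter_partial is f)"

text \<open>
  The function is total, but only its values on the open set \<open>U\<close> matter. Since \<^const>\<open>deriv\<close> is a
  total operator, the existence of every iterated partial derivative is required explicitly.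
\<close>
definition C_infinity_on :: "(real ^ 'n) set \<Rightarrow> (real ^ 'n \<Rightarrow> real) \<Rightarrow> bool" where
  "C_infinity_on U f \<longleftrightarrow>
     (\<forall>is. continuous_on U (iter_partial is f) \<and>
        (\<forall>x\<in>U. \<forall>i. (\<lambda>t. iter_partial is f (x + t *\<^sub>R axis i 1)) differentiable (at 0)))"

definition completely_monotone :: "(real ^ 'n \<Rightarrow> real) \<Rightarrow> bool" where
  "completely_monotone f \<longleftrightarrow>
     C_infinity_on pos_orthant f \<and>
     (\<forall>is. \<forall>x\<in>pos_orthant. 0 \<le> (- 1) ^ length is * iter_partial is f x)"


section \<open>Quaternions\<close>

datatype quat = Quat (qRe: real) (qIm1: real) (qIm2: real) (qIm3: real)

lemma quat_eq_iff:
  "p = q \<longleftrightarrow> qRe p = qRe q \<and> qIm1 p = qIm1 q \<and> qIm2 p = qIm2 q \<and> qIm3 p = qIm3 q"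
  by (auto intro: quat.expand)

instantiation quat :: ab_group_add
begin

definition zero_quat :: quat where "0 = Quat 0 0 0 0"
definition plus_quat :: "quat \<Rightarrow> quat \<Rightarrow> quat" where
  "p + q = Quat (qRe p + qRe q) (qIm1 p + qIm1 q) (qIm2 p + qIm2 q) (qIm3 p + qIm3 q)"
definition uminus_quat :: "quat \<Rightarrow> quat" where
  "- q = Quat (- qRe q) (- qIm1 q) (- qIm2 q) (- qIm3 q)"
definition minus_quat :: "quat \<Rightarrow> quat \<Rightarrow> quat" where
  "p - q = Quat (qRe p - qRe q) (qIm1 p - qIm1 q) (qIm2 p - qIm2 q) (qIm3 p - qIm3 q)"

instance
  by standard
    (simp_all add: quat_eq_iff zero_quat_def plus_quat_def uminus_quat_def minus_quat_def)

end

instantiation quat :: real_algebra_1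
begin

definition scaleR_quat :: "real \<Rightarrow> quat \<Rightarrow> quat" where
  "r *\<^sub>R q = Quat (r * qRe q) (r * qIm1 q) (r * qIm2 q) (r * qIm3 q)"
definition one_quat :: quat where "1 = Quat 1 0 0 0"
definition times_quat :: "quat \<Rightarrow> quat \<Rightarrow> quat" where
  "p * q = Quat
     (qRe p * qRe q - qIm1 p * qIm1 q - qIm2 p * qIm2 q - qIm3 p * qIm3 q)
     (qRe p * qIm1 q + qIm1 p * qRe q + qIm2 p * qIm3 q - qIm3 p * qIm2 q)
     (qRe p * qIm2 q - qIm1 p * qIm3 q + qIm2 p * qRe q + qIm3 p * qIm1 q)
     (qRe p * qIm3 q + qIm1 p * qIm2 q - qIm2 p * qIm1 q + qIm3 p * qRe q)"

instance
  by standard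
    (simp_all add: quat_eq_iff zero_quat_def plus_quat_def scaleR_quat_def one_quat_def
       times_quat_def algebra_simps)

end

lemma quat_sel_simps [simp]:
  "qRe 0 = 0" "qIm1 0 = 0" "qIm2 0 = 0" "qIm3 0 = 0"
  "qRe 1 = 1" "qIm1 1 = 0" "qIm2 1 = 0" "qIm3 1 = 0"
  "qRe (p + q) = qRe p + qRe q" "qIm1 (p + q) = qIm1 p + qIm1 q"
  "qIm2 (p + q) = qIm2 p + qIm2 q" "qIm3 (p + q) = qIm3 p + qIm3 q"
  "qRe (- q) = - qRe q" "qIm1 (- q) = - qIm1 q" "qIm2 (- q) = - qIm2 q" "qIm3 (- q) = - qIm3 q"
  "qRe (p - q) = qRe p - qRe q" "qIm1 (p - q) = qIm1 p - qIm1 q"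
  "qIm2 (p - q) = qIm2 p - qIm2 q" "qIm3 (p - q) = qIm3 p - qIm3 q"
  "qRe (r *\<^sub>R q) = r * qRe q" "qIm1 (r *\<^sub>R q) = r * qIm1 q"
  "qIm2 (r *\<^sub>R q) = r * qIm2 q" "qIm3 (r *\<^sub>R q) = r * qIm3 q"
  "qRe (p * q) = qRe p * qRe q - qIm1 p * qIm1 q - qIm2 p * qIm2 q - qIm3 p * qIm3 q"
  "qIm1 (p * q) = qRe p * qIm1 q + qIm1 p * qRe q + qIm2 p * qIm3 q - qIm3 p * qIm2 q"
  "qIm2 (p * q) = qRe p * qIm2 q - qIm1 p * qIm3 q + qIm2 p * qRe q + qIm3 p * qIm1 q"
  "qIm3 (p * q) = qRe p * qIm3 q + qIm1 p * qIm2 q - qIm2 p * qIm1 q + qIm3 p * qRe q"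
  by (simp_all add: zero_quat_def one_quat_def plus_quat_def uminus_quat_def minus_quat_def
        scaleR_quat_def times_quat_def)

definition qcnj :: "quat \<Rightarrow> quat" where
  "qcnj q = Quat (qRe q) (- qIm1 q) (- qIm2 q) (- qIm3 q)"

definition qnorm_sq :: "quat \<Rightarrow> real" where
  "qnorm_sq q = (qRe q)\<^sup>2 + (qIm1 q)\<^sup>2 + (qIm2 q)\<^sup>2 + (qIm3 q)\<^sup>2"

lemma qnorm_sq_eq_0_iff: "qnorm_sq q = 0 \<longleftrightarrow> q = 0"
proof
  assume *: "qnorm_sq q = 0"
  have "(qRe q)\<^sup>2 \<ge> 0" "(qIm1 q)\<^sup>2 \<ge> 0" "(qIm2 q)\<^sup>2 \<ge> 0" "(qIm3 q)\<^sup>2 \<ge> 0"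
    by simp_all
  with * have "(qRe q)\<^sup>2 = 0" "(qIm1 q)\<^sup>2 = 0" "(qIm2 q)\<^sup>2 = 0" "(qIm3 q)\<^sup>2 = 0"
    unfolding qnorm_sq_def by linarith+
  then show "q = 0"
    by (simp add: quat_eq_iff)
qed (simp add: qnorm_sq_def)

lemma qcnj_mult_self: "qcnj q * q = qnorm_sq q *\<^sub>R 1" "q * qcnj q = qnorm_sq q *\<^sub>R 1"
  by (simp_all add: quat_eq_iff qcnj_def qnorm_sq_def power2_eq_square)

instantiation quat :: real_div_algebra
begin

definition inverse_quat :: "quat \<Rightarrow> quat" where
  "inverse q = (1 / qnorm_sq q) *\<^sub>R qcnj q"
definition divide_quat :: "quat \<Rightarrow> quat \<Rightarrow> quat" where
  "p div (q :: quat) = p * inverse q"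

instance
proof
  fix q :: quat
  assume "q \<noteq> 0"
  then have "qnorm_sq q \<noteq> 0"
    by (simp add: qnorm_sq_eq_0_iff)
  then show "inverse q * q = 1" "q * inverse q = 1"
    by (simp_all add: inverse_quat_def qcnj_mult_self)
qed (simp_all add: divide_quat_def inverse_quat_def qcnj_def quat_eq_iff)

end


section \<open>Positive-semidefinite matrices\<close>

definition real_psd :: "real ^ 'm ^ 'm \<Rightarrow> bool" where
  "real_psd M \<longleftrightarrow> transpose M = M \<and> (\<forall>v. 0 \<le> v \<bullet> (M *v v))"

definition complex_psd :: "complex ^ 'm ^ 'm \<Rightarrow> bool" where
  "complex_psd M \<longleftrightarrow>
     (\<chi> i j. cnj (M $ j $ i)) = M \<and>
     (\<forall>v. (\<Sum>i\<in>UNIV. cnj (v $ i) * (M *v v) $ i) \<in> \<real>\<^sub>\<ge>\<^sub>0)"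

definition quat_psd :: "quat ^ 'm ^ 'm \<Rightarrow> bool" where
  "quat_psd M \<longleftrightarrow>
     (\<chi> i j. qcnj (M $ j $ i)) = M \<and>
     (\<forall>v. (\<Sum>i\<in>UNIV. qcnj (v $ i) * (M *v v) $ i) \<in> \<real>\<^sub>\<ge>\<^sub>0)"


section \<open>Rank of a quaternionic matrix\<close>

text \<open>
  The library's \<^const>\<open>rank\<close> needs a field of scalars, so the left row rank is defined here, as the
  largest number of rows (counted by index) that are left-linearly independent; \<open>*s\<close> multiplies
  each component by the scalar on the left.
\<close>
definition rows_left_independent :: "quat ^ 'k ^ 'm \<Rightarrow> 'm set \<Rightarrow> bool" where
  "rows_left_independent M I \<longleftrightarrow>
     (\<forall>c. (\<Sum>i\<in>I. c i *s row i M) = 0 \<longrightarrow> (\<forall>i\<in>I. c i = 0))"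

definition quat_rank :: "quat ^ 'k ^ 'm \<Rightarrow> nat" where
  "quat_rank M = Max {card I | I. rows_left_independent M I}"


section \<open>Pfaffian and Moore determinant\<close>

definition block_matrix ::
    "'a ^ 'm ^ 'm \<Rightarrow> 'a ^ 'm ^ 'm \<Rightarrow> 'a ^ 'm ^ 'm \<Rightarrow> 'a ^ 'm ^ 'm \<Rightarrow> 'a ^ ('m::finite + 'm) ^ ('m + 'm)" where
  "block_matrix A B C D =
     (\<chi> p q. case p of
        Inl i \<Rightarrow> (case q of Inl j \<Rightarrow> A $ i $ j | Inr j \<Rightarrow> B $ i $ j)
      | Inr i \<Rightarrow> (case q of Inl j \<Rightarrow> C $ i $ j | Inr j \<Rightarrow> D $ i $ j))"

definition J_mat :: "complex ^ ('m::finite + 'm) ^ ('m + 'm)" where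
  "J_mat = block_matrix 0 (mat 1) (- mat 1) 0"

definition antisymmetric :: "complex ^ 'k ^ 'k \<Rightarrow> bool" where
  "antisymmetric Y \<longleftrightarrow> transpose Y = - Y"

inductive entry_polynomial :: "(complex ^ 'k ^ 'k \<Rightarrow> complex) \<Rightarrow> bool" where
  "entry_polynomial (\<lambda>Y. c)"
| "entry_polynomial (\<lambda>Y. Y $ i $ j)"
| "entry_polynomial p \<Longrightarrow> entry_polynomial q \<Longrightarrow> entry_polynomial (\<lambda>Y. p Y + q Y)"
| "entry_polynomial p \<Longrightarrow> entry_polynomial q \<Longrightarrow> entry_polynomial (\<lambda>Y. p Y * q Y)"

definition pfaffian_polynomial :: "(complex ^ ('m::finite + 'm) ^ ('m + 'm) \<Rightarrow> complex) \<Rightarrow> bool" where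
  "pfaffian_polynomial p \<longleftrightarrow>
     entry_polynomial p \<and> (\<forall>Y. antisymmetric Y \<longrightarrow> (p Y)\<^sup>2 = det Y) \<and> p J_mat = 1"

text \<open>
  The pfaffian is unique only as a function on antisymmetric matrices: polynomials in all \<open>(2m)\<^sup>2\<close>
  entries may differ elsewhere. The description is therefore on the value at \<open>Y\<close>; it is meaningful
  for antisymmetric \<open>Y\<close>, where \<open>pfaffian_polynomial_unique\<close> below applies.
\<close>
definition pfaffian :: "complex ^ ('m::finite + 'm) ^ ('m + 'm) \<Rightarrow> complex" where
  "pfaffian Y = (THE z. \<exists>p. pfaffian_polynomial p \<and> z = p Y)"

definition quat_fst :: "quat \<Rightarrow> complex" where
  "quat_fst q = Complex (qRe q) (qIm1 q)"

definition quat_snd :: "quat \<Rightarrow> complex" where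
  "quat_snd q = Complex (qIm2 q) (qIm3 q)"

text \<open>The next lemma is the decomposition \<open>q = a + b j\<close> with complex \<open>a\<close> and \<open>b\<close>.\<close>

lemma quat_decomposition:
  "q = Quat (Re (quat_fst q)) (Im (quat_fst q)) 0 0
     + Quat (Re (quat_snd q)) (Im (quat_snd q)) 0 0 * Quat 0 0 1 0"
  by (simp add: quat_eq_iff quat_fst_def quat_snd_def)

definition Psi :: "quat ^ 'm ^ 'm \<Rightarrow> complex ^ ('m::finite + 'm) ^ ('m + 'm)" where
  "Psi M =
     (let A = (\<chi> i j. quat_fst (M $ i $ j)); B = (\<chi> i j. quat_snd (M $ i $ j))
      in block_matrix A B (\<chi> i j. - cnj (B $ i $ j)) (\<chi> i j. cnj (A $ i $ j)))"

definition moore_det :: "quat ^ 'm ^ 'm \<Rightarrow> complex" where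
  "moore_det M = pfaffian (J_mat ** Psi M)"

lemma antisymmetric_iff: "antisymmetric Y \<longleftrightarrow> (\<forall>i j. Y $ j $ i = - Y $ i $ j)"
  by (simp only: antisymmetric_def transpose_def vec_eq_iff vec_lambda_beta vector_uminus_component)

lemma antisymmetric_J_mat: "antisymmetric (J_mat :: complex ^ ('m::finite + 'm) ^ ('m + 'm))"
proof -
  have "J_mat $ q $ p = - (J_mat $ p $ q :: complex)" for p q :: "'m + 'm"
    by (cases p; cases q) (simp_all add: J_mat_def block_matrix_def mat_def)
  then show ?thesis
    unfolding antisymmetric_iff by blast
qed

lemma entry_polynomial_on_line:
  assumes "entry_polynomial p"
  shows "\<exists>q. \<forall>t. p (X + (\<chi> i j. t * Z $ i $ j)) = poly q t"
  using assms
proof induction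
  case (1 c)
  show ?case by (rule exI[of _ "[:c:]"]) simp
next
  case (2 i j)
  show ?case by (rule exI[of _ "[:X $ i $ j, Z $ i $ j:]"]) simp
next
  case (3 p q)
  then obtain p' q' where "\<forall>t. p (X + (\<chi> i j. t * Z $ i $ j)) = poly p' t"
    "\<forall>t. q (X + (\<chi> i j. t * Z $ i $ j)) = poly q' t" by blast
  then show ?case by (intro exI[of _ "p' + q'"]) simp
next
  case (4 p q)
  then obtain p' q' where "\<forall>t. p (X + (\<chi> i j. t * Z $ i $ j)) = poly p' t"
    "\<forall>t. q (X + (\<chi> i j. t * Z $ i $ j)) = poly q' t" by blast
  then show ?case by (intro exI[of _ "p' * q'"]) simp
qed

lemma pfaffian_polynomial_unique:
  fixes Y :: "complex ^ ('m::finite + 'm) ^ ('m + 'm)"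
  assumes p: "pfaffian_polynomial p" and q: "pfaffian_polynomial q" and Y: "antisymmetric Y"
  shows "p Y = q Y"
proof -
  define L where "L t = J_mat + (\<chi> i j. t * (Y - J_mat) $ i $ j)" for t :: complex
  have L: "antisymmetric (L t)" for t
  proof -
    have "L t $ j $ i = - L t $ i $ j" for i j
    proof -
      have "Y $ j $ i = - Y $ i $ j" "J_mat $ j $ i = - (J_mat $ i $ j :: complex)"
        using Y antisymmetric_J_mat unfolding antisymmetric_iff by blast+
      then show ?thesis
        unfolding L_def vector_add_component vec_lambda_beta vector_minus_component
        by algebra
    qed
    then show ?thesis
      unfolding antisymmetric_iff by blast
  qed
  have L01: "L 0 = J_mat" "L 1 = Y"
    by (simp_all add: L_def vec_eq_iff)
  obtain p' where p': "\<And>t. p (L t) = poly p' t"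
    using entry_polynomial_on_line[of p J_mat "Y - J_mat"] p
    unfolding pfaffian_polynomial_def L_def by blast
  obtain q' where q': "\<And>t. q (L t) = poly q' t"
    using entry_polynomial_on_line[of q J_mat "Y - J_mat"] q
    unfolding pfaffian_polynomial_def L_def by blast
  have "poly (p'\<^sup>2) t = poly (q'\<^sup>2) t" for t
    using p q L[of t] by (simp add: pfaffian_polynomial_def flip: p' q')
  then have "p'\<^sup>2 = q'\<^sup>2"
    by (simp add: fun_eq_iff flip: poly_eq_poly_eq_iff)
  then have "p' = q' \<or> p' = - q'"
    by (simp add: power2_eq_iff)
  moreover have "poly p' 0 = 1" "poly q' 0 = 1"
    using p q by (simp_all add: pfaffian_polynomial_def L01 flip: p' q')
  ultimately have "p' = q'"
    by auto
  then show ?thesis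
    using p'[of 1] q'[of 1] by (simp add: L01)
qed

lemma pfaffian_eqI:
  assumes "pfaffian_polynomial p" and "antisymmetric Y"
  shows "pfaffian Y = p Y"
  unfolding pfaffian_def using assms by (blast intro: pfaffian_polynomial_unique)

end

theory Submission
  imports Defs "HOL-Probability.Distributions"
begin

text \<open>
  Let \<open>X\<close> be the positive-definite matrix \<open>\<Sum>i. x\<^sub>i A\<^sub>i\<close>. For every vector \<open>v\<close> the function
  \<open>exp (- v\<^sup>* X v)\<close> of \<open>x\<close> is completely monotone, because every \<open>v\<^sup>* A\<^sub>i v\<close> is nonnegative, and
  complete monotonicity survives products and integration over a parameter. Let \<open>d\<close> be the real
  dimension of the scalars and \<open>p\<^sub>1, \<dots>, p\<^sub>m\<close> the pivots of Gaussian elimination, whose product is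
  the determinant. Integrating out the first \<open>r\<close> coordinates of \<open>v\<close>, one real Gaussian integral at
  a time, leaves a constant times \<open>(p\<^sub>1 \<cdots> p\<^sub>r)\<close> to the power \<open>- d/2\<close> times \<open>exp\<close> of minus the
  Schur complement form. For \<open>r = m\<close> this gives the exponent \<open>- d/2\<close>, and products give its
  multiples. With \<open>sqrt t\<close> as coordinate \<open>r + 1\<close> of \<open>v\<close> and zeros after it, integration against
  \<open>t\<close> to the power \<open>\<beta> - 1\<close> turns the last factor into \<open>p\<^sub>r\<^sub>+\<^sub>1\<close> to the power \<open>- \<beta>\<close>;
  multiplication by \<open>(p\<^sub>1 \<cdots> p\<^sub>r)\<close> to the power \<open>- (\<beta> - d/2)\<close> gives an induction on \<open>r\<close> for all
  real \<open>\<beta> \<ge> (m - 1) d/2\<close>. In the quaternionic case the elimination identity for the Moore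
  determinant comes from \<open>pf (B\<^sup>T Y B) = det B pf Y\<close>, where the Pfaffian is the usual signed sum over
  permutations.
\<close>


section \<open>Completely monotone functions\<close>

lemma orthant_line_eventually:
  assumes "x \<in> pos_orthant"
  shows "\<forall>\<^sub>F t in nhds 0. x + t *\<^sub>R axis i 1 \<in> pos_orthant"
proof -
  have "\<forall>\<^sub>F t in nhds (0::real). t > - (x $ i)"
    using assms by (intro order_tendstoD[OF filterlim_ident]) (auto simp: pos_orthant_def)
  then show ?thesis
    by eventually_elim (use assms in \<open>auto simp: pos_orthant_def axis_def\<close>)
qed

text \<open>By induction on the list of indices, every iterated partial derivative of
  \<open>f\<close> agrees on the orthant, up to the sign \<open>(- 1) ^ length is\<close>, with a
  member of \<open>F\<close>. Continuity, differentiability and the sign condition are then read off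
  from that member. This reduces each later proof to finding a family that is closed under the
  negative of every partial derivative.\<close>

lemma completely_monotone_coinduct:
  fixes f :: "real ^ 'n \<Rightarrow> real"
  assumes f: "f \<in> F"
    and cont: "\<And>f. f \<in> F \<Longrightarrow> continuous_on pos_orthant f"
    and nonneg: "\<And>f x. f \<in> F \<Longrightarrow> x \<in> pos_orthant \<Longrightarrow> 0 \<le> f x"
    and deriv: "\<And>f i. f \<in> F \<Longrightarrow> \<exists>g\<in>F. \<forall>x\<in>pos_orthant.
        ((\<lambda>t. f (x + t *\<^sub>R axis i 1)) has_real_derivative - g x) (at 0)"
  shows "completely_monotone f"
proof -
  \<comment> \<open>The relation between \<open>h\<close> and \<open>g\<close> is known only on the
    orthant. Since the orthant is open, it holds along the line near \<open>t = 0\<close>, which is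
    all that the derivative sees.\<close>
  have step: "((\<lambda>t. h (x + t *\<^sub>R axis i 1)) has_real_derivative (- 1) ^ Suc n * g' x) (at 0)"
    if h: "\<forall>x\<in>pos_orthant. h x = (- 1) ^ n * g x"
      and g': "\<forall>x\<in>pos_orthant. ((\<lambda>t. g (x + t *\<^sub>R axis i 1)) has_real_derivative - g' x) (at 0)"
      and x: "x \<in> pos_orthant"
    for h g g' :: "real ^ 'n \<Rightarrow> real" and n i x
  proof -
    have "((\<lambda>t. (- 1) ^ n * g (x + t *\<^sub>R axis i 1)) has_real_derivative (- 1) ^ n
        * (- g' x)) (at 0)"
      by (rule DERIV_cmult) (use g' x in blast)
    moreover have "\<forall>\<^sub>F t in nhds 0. (- 1) ^ n * g (x + t *\<^sub>R axis i 1) = h (x + t *\<^sub>R axis i 1)"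
      using orthant_line_eventually[OF x, of i] by eventually_elim (use h in auto)
    ultimately show ?thesis
      by (subst (asm) DERIV_cong_ev) auto
  qed
  have main: "\<exists>g\<in>F. \<forall>x\<in>pos_orthant. iter_partial is f x = (- 1) ^ length is * g x" for "is"
  proof (induction "is")
    case (Cons i "is")
    then obtain g where g: "g \<in> F" "\<forall>x\<in>pos_orthant. iter_partial is f x = (- 1) ^ length is * g x"
      by blast
    obtain g' where g': "g' \<in> F"
      "\<forall>x\<in>pos_orthant. ((\<lambda>t. g (x + t *\<^sub>R axis i 1)) has_real_derivative - g' x) (at 0)"
      using deriv[OF g(1)] by blast
    show ?case
      using g'(1) step[OF g(2) g'(2)]
      by (intro bexI[of _ g']) (auto simp: partial_def dest!: DERIV_imp_deriv)
  qed (use f in auto)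
  have "continuous_on pos_orthant (iter_partial is f)" for "is"
  proof -
    obtain g where "g \<in> F" "\<forall>x\<in>pos_orthant. iter_partial is f x = (- 1) ^ length is * g x"
      using main by blast
    then show ?thesis
      using cont by (subst continuous_on_cong[OF refl]) (auto intro!: continuous_intros)
  qed
  moreover have "(\<lambda>t. iter_partial is f (x + t *\<^sub>R axis i 1)) differentiable (at 0)"
    if x: "x \<in> pos_orthant" for "is" x i
  proof -
    obtain g where g: "g \<in> F" "\<forall>x\<in>pos_orthant. iter_partial is f x = (- 1) ^ length is * g x"
      using main by blast
    obtain g' where g': "g' \<in> F"
      "\<forall>x\<in>pos_orthant. ((\<lambda>t. g (x + t *\<^sub>R axis i 1)) has_real_derivative - g' x) (at 0)"
      using deriv[OF g(1)] by blast
    show ?thesis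
      using step[OF g(2) g'(2) x] by (auto simp: real_differentiable_def)
  qed
  moreover have "0 \<le> (- 1) ^ length is * iter_partial is f x" if x: "x \<in> pos_orthant" for "is" x
  proof -
    obtain g where "g \<in> F" "\<forall>x\<in>pos_orthant. iter_partial is f x = (- 1) ^ length is * g x"
      using main by blast
    then show ?thesis
      using nonneg x by (simp flip: mult.assoc power_mult_distrib)
  qed
  ultimately show ?thesis
    by (auto simp: completely_monotone_def C_infinity_on_def)
qed

section \<open>Consequences of the definition and closure properties\<close>

lemma completely_monotone_continuous:
  "completely_monotone f \<Longrightarrow> continuous_on pos_orthant f"
  unfolding completely_monotone_def C_infinity_on_def by (metis iter_partial.simps(1))

lemma completely_monotone_nonneg:
  "completely_monotone f \<Longrightarrow> x \<in> pos_orthant \<Longrightarrow> 0 \<le> f x"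
  unfolding completely_monotone_def
  by (metis iter_partial.simps(1) list.size(3) mult_1 power_0)

lemma completely_monotone_has_derivative:
  assumes "completely_monotone f" "x \<in> pos_orthant"
  shows "((\<lambda>t. f (x + t *\<^sub>R axis i 1)) has_real_derivative partial i f x) (at 0)"
proof -
  have "(\<lambda>t. iter_partial [] f (x + t *\<^sub>R axis i 1)) differentiable (at 0)"
    using assms unfolding completely_monotone_def C_infinity_on_def by blast
  then show ?thesis
    by (auto simp: partial_def real_differentiable_def DERIV_imp_deriv)
qed

text \<open>The signed iterated partial derivatives of \<open>f\<close> form a suitable family:
  differentiating one of them puts an index at the head of its list.\<close>

lemma completely_monotone_partial:
  assumes f: "completely_monotone f"
  shows "completely_monotone (\<lambda>x. - partial i f x)"
proof -
  define F where "F = range (\<lambda>is x. (- 1) ^ length is * iter_partial is f x)"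
  show ?thesis
  proof (rule completely_monotone_coinduct[where F = F])
    show "(\<lambda>x. - partial i f x) \<in> F"
      by (auto simp: F_def intro!: image_eqI[of _ _ "[i]"])
  next
    fix g assume "g \<in> F"
    then obtain "is" where g: "g = (\<lambda>x. (- 1) ^ length is * iter_partial is f x)"
      by (auto simp: F_def)
    have C: "continuous_on pos_orthant (iter_partial is f)"
      "\<And>x i. x \<in> pos_orthant \<Longrightarrow>
        (\<lambda>t. iter_partial is f (x + t *\<^sub>R axis i 1)) differentiable (at 0)"
      "\<And>x. x \<in> pos_orthant \<Longrightarrow> 0 \<le> g x"
      using f unfolding completely_monotone_def C_infinity_on_def g by blast+
    show "continuous_on pos_orthant g"
      unfolding g by (intro continuous_intros C)
    show "0 \<le> g x" if "x \<in> pos_orthant" for x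
      using C(3) that .
    fix j
    show "\<exists>h\<in>F. \<forall>x\<in>pos_orthant.
        ((\<lambda>t. g (x + t *\<^sub>R axis j 1)) has_real_derivative - h x) (at 0)"
    proof (intro bexI ballI)
      fix x :: "real ^ 'a" assume x: "x \<in> pos_orthant"
      have "((\<lambda>t. iter_partial is f (x + t *\<^sub>R axis j 1)) has_real_derivative
          iter_partial (j # is) f x) (at 0)"
        using C(2)[OF x, of j] by (auto simp: partial_def real_differentiable_def DERIV_imp_deriv)
      from DERIV_cmult[OF this, of "(- 1) ^ length is"]
      show "((\<lambda>t. g (x + t *\<^sub>R axis j 1)) has_real_derivative
          - ((- 1) ^ length (j # is) * iter_partial (j # is) f x)) (at 0)"
        by (simp add: g)
    qed (auto simp: F_def intro!: image_eqI[of _ _ "j # is"])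
  qed
qed

text \<open>Iterated derivatives at a point of the open orthant depend only on the values nearby.
  The lemma lets formulas that hold only for positive bases or nonzero pivots be rewritten under
  \<open>completely_monotone\<close>.\<close>

lemma completely_monotone_cong:
  assumes f: "completely_monotone f" and eq: "\<And>x. x \<in> pos_orthant \<Longrightarrow> f x = g x"
  shows "completely_monotone g"
proof (rule completely_monotone_coinduct[where
      F = "{g. \<exists>f. completely_monotone f \<and> (\<forall>x\<in>pos_orthant. f x = g x)}"])
  fix g :: "real ^ 'a \<Rightarrow> real"
  assume "g \<in> {g. \<exists>f. completely_monotone f \<and> (\<forall>x\<in>pos_orthant. f x = g x)}"
  then obtain f where f: "completely_monotone f" "\<And>x. x \<in> pos_orthant \<Longrightarrow> f x = g x"
    by blast
  show "continuous_on pos_orthant g"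
    using completely_monotone_continuous[OF f(1)] f(2) continuous_on_cong[OF refl, of pos_orthant
        f g]
    by blast
  show "0 \<le> g x" if "x \<in> pos_orthant" for x
    using completely_monotone_nonneg[OF f(1) that] f(2)[OF that] by simp
  fix i
  show "\<exists>h\<in>{g. \<exists>f. completely_monotone f \<and> (\<forall>x\<in>pos_orthant. f x = g x)}.
      \<forall>x\<in>pos_orthant. ((\<lambda>t. g (x + t *\<^sub>R axis i 1)) has_real_derivative - h x) (at 0)"
  proof (intro bexI ballI)
    fix x :: "real ^ 'a" assume x: "x \<in> pos_orthant"
    have "\<forall>\<^sub>F t in nhds 0. f (x + t *\<^sub>R axis i 1) = g (x + t *\<^sub>R axis i 1)"
      using orthant_line_eventually[OF x, of i] by eventually_elim (use f in auto)
    then show "((\<lambda>t. g (x + t *\<^sub>R axis i 1)) has_real_derivative - (- partial i f x)) (at 0)"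
      using completely_monotone_has_derivative[OF f(1) x, of i]
      by (subst (asm) DERIV_cong_ev) auto
  qed (use completely_monotone_partial[OF f(1)] in blast)
qed (use assms in auto)

text \<open>By the Leibniz rule, minus the derivative of a product is a sum of two products.
  Products alone are therefore not closed under differentiation, but their finite sums are.\<close>

inductive product_sum :: "(real ^ 'n \<Rightarrow> real) \<Rightarrow> bool" where
  mult: "completely_monotone f \<Longrightarrow> completely_monotone g \<Longrightarrow> product_sum (\<lambda>x. f x * g x)"
| add: "product_sum f \<Longrightarrow> product_sum g \<Longrightarrow> product_sum (\<lambda>x. f x + g x)"

lemma completely_monotone_mult:
  assumes "completely_monotone f" "completely_monotone g"
  shows "completely_monotone (\<lambda>x. f x * g x)"
proof (rule completely_monotone_coinduct[where F = "Collect product_sum"])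
  fix f :: "real ^ 'a \<Rightarrow> real"
  assume "f \<in> Collect product_sum"
  then have f: "product_sum f" by simp
  then show "continuous_on pos_orthant f"
    by induction (simp_all add: continuous_on_mult continuous_on_add completely_monotone_continuous)
  show "0 \<le> f x" if "x \<in> pos_orthant" for x
    using f by induction (simp_all add: completely_monotone_nonneg that)
  fix i
  from f show "\<exists>h\<in>Collect product_sum.
      \<forall>x\<in>pos_orthant. ((\<lambda>t. f (x + t *\<^sub>R axis i 1)) has_real_derivative - h x) (at 0)"
  proof induction
    case (mult f g)
    let ?h = "\<lambda>x. - partial i f x * g x + f x * - partial i g x"
    have "((\<lambda>t. f (x + t *\<^sub>R axis i 1) * g (x + t *\<^sub>R axis i 1)) has_real_derivative - ?h x) (at 0)"
      if "x \<in> pos_orthant" for x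
      using DERIV_mult[OF completely_monotone_has_derivative[OF mult(1) that, of i]
          completely_monotone_has_derivative[OF mult(2) that, of i]]
      by (rule DERIV_cong) simp
    moreover have "product_sum ?h"
      using product_sum.add[OF product_sum.mult[OF completely_monotone_partial[OF mult(1)] mult(2)]
          product_sum.mult[OF mult(1) completely_monotone_partial[OF mult(2)]]] .
    ultimately show ?case
      by (intro bexI[of _ ?h]) auto
  next
    case (add f g)
    from add.IH obtain f' g' where f': "product_sum f'" "product_sum g'"
      "\<And>x. x \<in> pos_orthant \<Longrightarrow> ((\<lambda>t. f (x + t *\<^sub>R axis i 1)) has_real_derivative - f' x) (at 0)"
      "\<And>x. x \<in> pos_orthant \<Longrightarrow> ((\<lambda>t. g (x + t *\<^sub>R axis i 1)) has_real_derivative - g' x) (at 0)"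
      by auto
    show ?case
    proof (intro bexI[of _ "\<lambda>x. f' x + g' x"] ballI)
      fix x :: "real ^ 'a" assume x: "x \<in> pos_orthant"
      show "((\<lambda>t. f (x + t *\<^sub>R axis i 1) + g (x + t *\<^sub>R axis i 1)) has_real_derivative
          - (f' x + g' x)) (at 0)"
        using DERIV_add[OF f'(3,4)[OF x]] by (rule DERIV_cong) simp
    qed (simp add: product_sum.add[OF f'(1,2)])
  qed
qed (simp add: product_sum.mult[OF assms])

lemma completely_monotone_const:
  assumes "0 \<le> c"
  shows "completely_monotone (\<lambda>_. c)"
proof (rule completely_monotone_coinduct[where F = "(\<lambda>c _. c) ` {0..}"])
  fix f :: "real ^ 'a \<Rightarrow> real" and i :: 'a
  assume "f \<in> (\<lambda>c _. c) ` {0..}"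
  then show "\<exists>h\<in>(\<lambda>c _. c) ` {0..}.
      \<forall>x\<in>pos_orthant. ((\<lambda>t. f (x + t *\<^sub>R axis i 1)) has_real_derivative - h x) (at 0)"
    by (intro bexI[of _ "\<lambda>_. 0"]) auto
qed (use assms in auto)

lemma completely_monotone_power:
  assumes "completely_monotone f"
  shows "completely_monotone (\<lambda>x. f x ^ k)"
  by (induction k) (simp_all add: completely_monotone_const completely_monotone_mult assms)

text \<open>Minus the derivative in direction \<open>i\<close> multiplies the exponential by
  \<open>a i\<close>, so the nonnegative multiples of the exponential form a closed family.\<close>

lemma completely_monotone_exp:
  fixes a :: "'n::finite \<Rightarrow> real"
  assumes a: "\<And>i. 0 \<le> a i"
  shows "completely_monotone (\<lambda>x :: real ^ 'n. exp (- (\<Sum>i\<in>UNIV. x $ i * a i)))"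
proof -
  define e where "e c x = c * exp (- (\<Sum>i\<in>UNIV. x $ i * a i))" for c and x :: "real ^ 'n"
  have "completely_monotone (e 1)"
  proof (rule completely_monotone_coinduct[where F = "e ` {0..}"])
    fix f :: "real ^ 'n \<Rightarrow> real" and i :: 'n
    assume "f \<in> e ` {0..}"
    then obtain c where c: "f = e c" "0 \<le> c" by auto
    show "continuous_on pos_orthant f"
      unfolding c e_def by (intro continuous_intros)
    show "0 \<le> f x" for x
      using c by (simp add: e_def)
    have "((\<lambda>t. e c (x + t *\<^sub>R axis i 1)) has_real_derivative - e (c * a i) x) (at 0)" for x
    proof -
      have "(\<Sum>j\<in>UNIV. (x + t *\<^sub>R axis i 1) $ j * a j) = (\<Sum>j\<in>UNIV. x $ j * a j) + t * a i" for t
      proof -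
        have "(\<Sum>j\<in>UNIV. axis i (1::real) $ j * a j) = a i"
          by (simp add: axis_def if_distrib[of "\<lambda>x. x * _"] cong: if_cong)
        then show ?thesis
          by (simp add: distrib_right sum.distrib mult.assoc flip: sum_distrib_left)
      qed
      then show ?thesis
        unfolding e_def by (auto intro!: derivative_eq_intros)
    qed
    then show "\<exists>h\<in>e ` {0..}.
        \<forall>x\<in>pos_orthant. ((\<lambda>t. f (x + t *\<^sub>R axis i 1)) has_real_derivative - h x) (at 0)"
      using c a by (intro bexI[of _ "e (c * a i)"]) auto
  qed auto
  then show ?thesis
    by (simp add: e_def[abs_def])
qed

section \<open>Monotonicity and difference quotients along coordinate lines\<close>

lemma completely_monotone_has_derivative_line:
  assumes f: "completely_monotone f" and x: "x + s *\<^sub>R axis i 1 \<in> pos_orthant"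
  shows "((\<lambda>t. f (x + t *\<^sub>R axis i 1)) has_real_derivative partial i f (x + s *\<^sub>R axis i 1)) (at s)"
proof -
  have "((\<lambda>t. f (x + (t + s) *\<^sub>R axis i 1)) has_real_derivative partial i f (x
      + s *\<^sub>R axis i 1)) (at 0)"
    using completely_monotone_has_derivative[OF f x, of i] by (simp add: algebra_simps)
  then show ?thesis
    using DERIV_shift[of "\<lambda>t. f (x + t *\<^sub>R axis i 1)" _ 0 s] by simp
qed

lemma orthant_line_iff:
  assumes "x \<in> pos_orthant"
  shows "x + t *\<^sub>R axis i 1 \<in> pos_orthant \<longleftrightarrow> - (x $ i) < t"
proof
  assume "x + t *\<^sub>R axis i 1 \<in> pos_orthant"
  then have "0 < (x + t *\<^sub>R axis i 1) $ i"
    unfolding pos_orthant_def by blast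
  then show "- (x $ i) < t"
    by (simp add: axis_def)
next
  assume "- (x $ i) < t"
  with assms show "x + t *\<^sub>R axis i 1 \<in> pos_orthant"
    by (auto simp: pos_orthant_def axis_def)
qed

lemma completely_monotone_antimono_line:
  assumes f: "completely_monotone f" and x: "x \<in> pos_orthant" and "- (x $ i) < s" "s \<le> t"
  shows "f (x + t *\<^sub>R axis i 1) \<le> f (x + s *\<^sub>R axis i 1)"
proof (rule DERIV_nonpos_imp_nonincreasing[OF \<open>s \<le> t\<close>])
  fix r assume "s \<le> r" "r \<le> t"
  then have *: "x + r *\<^sub>R axis i 1 \<in> pos_orthant"
    using assms by (simp add: orthant_line_iff)
  then have "partial i f (x + r *\<^sub>R axis i 1) \<le> 0"
    using completely_monotone_nonneg[OF completely_monotone_partial[OF f]] by force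
  then show "\<exists>y. ((\<lambda>t. f (x + t *\<^sub>R axis i 1)) has_real_derivative y) (at r) \<and> y \<le> 0"
    using completely_monotone_has_derivative_line[OF f *] by blast
qed

text \<open>The coordinates of \<open>x\<close> are raised to those of \<open>y\<close> one at a
  time; \<open>S\<close> is the set of those already raised, and every intermediate point stays in
  the orthant.\<close>

lemma completely_monotone_antimono:
  assumes f: "completely_monotone f" and x: "x \<in> pos_orthant" and le: "\<And>i. x $ i \<le> y $ i"
  shows "f y \<le> f x"
proof -
  have "f (\<chi> i. if i \<in> S then y $ i else x $ i) \<le> f x" if "finite S" for S
    using that
  proof induction
    case (insert k S)
    let ?z = "\<chi> i. if i \<in> S then y $ i else x $ i"
    have z: "?z \<in> pos_orthant"
      using x le by (auto simp: pos_orthant_def intro: less_le_trans)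
    have "f (?z + (y $ k - x $ k) *\<^sub>R axis k 1) \<le> f (?z + 0 *\<^sub>R axis k 1)"
      using z le by (intro completely_monotone_antimono_line[OF f z]) (auto simp: pos_orthant_def)
    moreover have "?z + (y $ k - x $ k) *\<^sub>R axis k 1
        = (\<chi> i. if i \<in> insert k S then y $ i else x $ i)"
      using insert by (auto simp: vec_eq_iff axis_def)
    ultimately show ?case
      using insert.IH by simp
  qed (simp add: vec_lambda_unique)
  from this[of UNIV] show ?thesis by (simp add: vec_lambda_unique)
qed

text \<open>Along the line the derivative is nonpositive and nondecreasing. A difference quotient is
  the derivative at some point not left of \<open>- h\<close>, hence at most as large in modulus as
  the derivative at a point \<open>z\<close> between \<open>- 2 * h\<close> and \<open>- h\<close>,
  which the mean value theorem bounds by the value of \<open>f\<close> at \<open>- 2 * h\<close>.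
  The bound does not depend on \<open>s\<close>, so it can dominate all quotients at once.\<close>

lemma completely_monotone_quotient_bound:
  assumes f: "completely_monotone f" and x: "x \<in> pos_orthant" and h: "0 < h" "2 * h < x $ i"
    and s: "s \<noteq> 0" "- h \<le> s"
  shows "\<bar>(f (x + s *\<^sub>R axis i 1) - f x) / s\<bar> \<le> f (x + (- 2 * h) *\<^sub>R axis i 1) / h"
proof -
  define \<phi> where "\<phi> t = f (x + t *\<^sub>R axis i 1)" for t
  define \<phi>' where "\<phi>' t = partial i f (x + t *\<^sub>R axis i 1)" for t
  have in_orth: "x + t *\<^sub>R axis i 1 \<in> pos_orthant" if "- 2 * h \<le> t" for t
    using that h x by (simp add: orthant_line_iff)
  have D: "(\<phi> has_real_derivative \<phi>' t) (at t)" if "- 2 * h \<le> t" for t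
    unfolding \<phi>_def[abs_def] \<phi>'_def
    by (rule completely_monotone_has_derivative_line[OF f in_orth[OF that]])
  have nonpos: "\<phi>' t \<le> 0" if "- 2 * h \<le> t" for t
    using completely_monotone_nonneg[OF completely_monotone_partial[OF f, of i] in_orth[OF that]]
    by (simp add: \<phi>'_def)
  have mono: "\<phi>' t \<le> \<phi>' r" if "- 2 * h \<le> t" "t \<le> r" for t r
    using completely_monotone_antimono_line[OF completely_monotone_partial[OF f, of i] x _
        that(2), of i] that h
    by (simp add: \<phi>'_def)
  have "\<exists>z. - 2 * h < z \<and> z < - h \<and> \<phi> (- h) - \<phi> (- 2 * h) = (- h - - 2 * h) * \<phi>' z"
    by (rule MVT2) (use h D in auto)
  then obtain z where z: "- 2 * h < z" "z < - h" "\<phi> (- h) - \<phi> (- 2 * h) = h * \<phi>' z"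
    by auto
  \<comment> \<open>Nonnegativity allows \<open>\<phi> (- h)\<close> to be dropped from
    \<open>- h * \<phi>' z = \<phi> (- 2 * h) - \<phi> (- h)\<close>.\<close>
  have "0 \<le> \<phi> (- h)"
    unfolding \<phi>_def by (rule completely_monotone_nonneg[OF f in_orth]) (use h in simp)
  then have B: "- \<phi>' z \<le> \<phi> (- 2 * h) / h"
    using z h by (simp add: field_simps)
  obtain y where y: "- h \<le> y" "(\<phi> s - \<phi> 0) / s = \<phi>' y"
  proof (cases "s > 0")
    case True
    have "\<exists>y. 0 < y \<and> y < s \<and> \<phi> s - \<phi> 0 = (s - 0) * \<phi>' y"
      by (rule MVT2) (use h D True in auto)
    then obtain y where "0 < y" "\<phi> s - \<phi> 0 = s * \<phi>' y" by auto
    then show ?thesis using that[of y] h True by simp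
  next
    case False
    have "\<exists>y. s < y \<and> y < 0 \<and> \<phi> 0 - \<phi> s = (0 - s) * \<phi>' y"
      by (rule MVT2) (use h D False s in auto)
    then obtain y where "s < y" "\<phi> s - \<phi> 0 = s * \<phi>' y" by auto
    then show ?thesis using that[of y] h False s by simp
  qed
  have "\<bar>(\<phi> s - \<phi> 0) / s\<bar> = - \<phi>' y"
    using y nonpos[of y] h by simp
  also have "\<dots> \<le> - \<phi>' z"
    using mono[of z y] z y by simp
  finally show ?thesis
    using B by (simp add: \<phi>_def)
qed

section \<open>Integration over a parameter\<close>

lemma orthant_sequence_bound:
  assumes x: "x \<in> pos_orthant" and u: "u \<longlonglongrightarrow> x"
  shows "\<forall>\<^sub>F n in sequentially. \<forall>i. ((1 / 2) *\<^sub>R x) $ i \<le> u n $ i"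
proof -
  have "\<forall>\<^sub>F n in sequentially. ((1 / 2) *\<^sub>R x) $ i < u n $ i" for i
    using x by (intro order_tendstoD[OF tendsto_vec_nth[OF u]]) (auto simp: pos_orthant_def)
  then have "\<forall>\<^sub>F n in sequentially. \<forall>i\<in>UNIV. ((1 / 2) *\<^sub>R x) $ i < u n $ i"
    by (intro eventually_ball_finite) auto
  then show ?thesis
    by eventually_elim (auto intro: less_imp_le)
qed

text \<open>Differentiation under the integral sign by dominated convergence. The dominating
  function is \<open>g\<close> itself at a point moved back along the axis, divided by
  \<open>h\<close>, and it is integrable because that point still lies in the orthant.\<close>

lemma integral_partial:
  fixes g :: "real ^ 'n \<Rightarrow> 'w \<Rightarrow> real"
  assumes cm: "\<And>t. completely_monotone (\<lambda>x. g x t)"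
    and int: "\<And>x. x \<in> pos_orthant \<Longrightarrow> integrable M (g x)"
    and x: "x \<in> pos_orthant"
  shows "integrable M (\<lambda>t. partial i (\<lambda>x. g x t) x)"
    and "((\<lambda>s. \<integral>t. g (x + s *\<^sub>R axis i 1) t \<partial>M) has_real_derivative
           (\<integral>t. partial i (\<lambda>x. g x t) x \<partial>M)) (at 0)"
proof -
  define h where "h = x $ i / 4"
  have h: "0 < h" "2 * h < x $ i"
    using x by (auto simp: h_def pos_orthant_def)
  define q where "q s t = (g (x + s *\<^sub>R axis i 1) t - g x t) / s" for s t
  define B where "B t = g (x + (- 2 * h) *\<^sub>R axis i 1) t / h" for t
  define D where "D t = partial i (\<lambda>x. g x t) x" for t
  have orth: "x + s *\<^sub>R axis i 1 \<in> pos_orthant" if "- 2 * h \<le> s" for s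
    using that h x by (simp add: orthant_line_iff)
  have q_int: "integrable M (q s)" if "- h \<le> s" for s
    unfolding q_def using int[OF orth, of s] int[OF x] h that by auto
  have q_bound: "norm (q s t) \<le> B t" if "s \<noteq> 0" "- h \<le> s" for s t
    unfolding q_def B_def using completely_monotone_quotient_bound[OF cm x h that, of t] by simp
  have B_int: "integrable M B"
    unfolding B_def using int[OF orth, of "- 2 * h"] by auto
  have q_lim: "((\<lambda>s. q s t) \<longlongrightarrow> D t) (at 0)" for t
    using completely_monotone_has_derivative[OF cm x, of i t]
    by (simp add: has_field_derivative_iff q_def D_def)
  \<comment> \<open>Dominated convergence applies to sequences, so an arbitrary null sequence
    \<open>u\<close> is used, shifted by \<open>N\<close> so that all its terms are at least
    \<open>- h\<close>. The pointwise limit also yields measurability of \<open>D\<close>.\<close>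
  have main: "integrable M D \<and> (\<lambda>n. \<integral>t. q (u n) t \<partial>M) \<longlonglongrightarrow> (\<integral>t. D t \<partial>M)"
    if u: "\<And>n. u n \<noteq> 0" "u \<longlonglongrightarrow> 0" for u
  proof -
    have "\<forall>\<^sub>F n in sequentially. - h < u n"
      using order_tendstoD(1)[OF u(2), of "- h"] h by simp
    then obtain N where N: "\<And>n. - h \<le> u (n + N)"
      unfolding eventually_sequentially by (metis le_add2 less_imp_le)
    have lim: "(\<lambda>n. q (u (n + N)) t) \<longlonglongrightarrow> D t" for t
    proof -
      have "filterlim (\<lambda>n. u (n + N)) (at 0) sequentially"
        using u(1) LIMSEQ_ignore_initial_segment[OF u(2), of N] by (auto simp: filterlim_at)
      from filterlim_compose[OF q_lim this] show ?thesis .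
    qed
    have meas: "D \<in> borel_measurable M"
      by (rule borel_measurable_LIMSEQ_real[OF lim]) (use q_int N in auto)
    have "integrable M D"
      by (rule integrable_dominated_convergence[where w = B and s = "\<lambda>n. q (u (n + N))"])
        (use meas q_int N B_int lim q_bound u(1) in auto)
    moreover have "(\<lambda>n. \<integral>t. q (u (n + N)) t \<partial>M) \<longlonglongrightarrow> (\<integral>t. D t \<partial>M)"
      by (rule integral_dominated_convergence[where w = B])
        (use meas q_int N B_int lim q_bound u(1) in auto)
    ultimately show ?thesis
      using LIMSEQ_offset[of "\<lambda>n. \<integral>t. q (u n) t \<partial>M"] by blast
  qed
  have "integrable M D"
    using main[of "\<lambda>n. inverse (real (Suc n))"] LIMSEQ_inverse_real_of_nat by auto
  then show "integrable M (\<lambda>t. partial i (\<lambda>x. g x t) x)"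
    by (simp add: D_def[abs_def])
  have "((\<lambda>s. \<integral>t. q s t \<partial>M) \<longlongrightarrow> (\<integral>t. D t \<partial>M)) (at 0)"
    unfolding tendsto_at_iff_sequentially using main by (auto simp: o_def)
  moreover have "\<forall>\<^sub>F s in at 0. (\<integral>t. q s t \<partial>M) =
      ((\<integral>t. g (x + s *\<^sub>R axis i 1) t \<partial>M) - (\<integral>t. g x t \<partial>M)) / s"
  proof -
    have "\<forall>\<^sub>F s in at (0::real). s > - h"
      using h by (intro order_tendstoD[OF tendsto_ident_at]) auto
    then show ?thesis
      by eventually_elim (use int[OF orth] int[OF x] h in \<open>simp add: q_def\<close>)
  qed
  ultimately have "((\<lambda>s. ((\<integral>t. g (x + s *\<^sub>R axis i 1) t \<partial>M) - (\<integral>t. g x t \<partial>M)) / s)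
      \<longlongrightarrow> (\<integral>t. D t \<partial>M)) (at 0)"
    using tendsto_cong by force
  then show "((\<lambda>s. \<integral>t. g (x + s *\<^sub>R axis i 1) t \<partial>M) has_real_derivative
      (\<integral>t. partial i (\<lambda>x. g x t) x \<partial>M)) (at 0)"
    by (simp add: has_field_derivative_iff D_def[abs_def])
qed

text \<open>Points near \<open>x\<close> are eventually above \<open>x / 2\<close> in every
  coordinate, so by antitonicity the integrable function \<open>g (x / 2)\<close> dominates.\<close>

lemma integral_continuous_on_orthant:
  fixes g :: "real ^ 'n \<Rightarrow> 'w \<Rightarrow> real"
  assumes cm: "\<And>t. completely_monotone (\<lambda>x. g x t)"
    and int: "\<And>x. x \<in> pos_orthant \<Longrightarrow> integrable M (g x)"
  shows "continuous_on pos_orthant (\<lambda>x. \<integral>t. g x t \<partial>M)"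
  unfolding continuous_on_sequentially
proof (intro allI ballI impI)
  fix u and x :: "real ^ 'n"
  assume x: "x \<in> pos_orthant" and "(\<forall>n. u n \<in> pos_orthant) \<and> u \<longlonglongrightarrow> x"
  then have u: "\<And>n. u n \<in> pos_orthant" "u \<longlonglongrightarrow> x" by auto
  let ?x = "(1 / 2) *\<^sub>R x"
  have x2: "?x \<in> pos_orthant"
    using x by (simp add: pos_orthant_def)
  obtain N where N: "\<And>n i. ?x $ i \<le> u (n + N) $ i"
    using orthant_sequence_bound[OF x u(2)] unfolding eventually_sequentially by (metis le_add2)
  have "(\<lambda>n. \<integral>t. g (u (n + N)) t \<partial>M) \<longlonglongrightarrow> (\<integral>t. g x t \<partial>M)"
  proof (rule integral_dominated_convergence[where w = "g ?x"])
    show "AE t in M. (\<lambda>n. g (u (n + N)) t) \<longlonglongrightarrow> g x t"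
    proof (rule AE_I2)
      fix t
      have "(\<lambda>n. g (u n) t) \<longlonglongrightarrow> g x t"
        using completely_monotone_continuous[OF cm, of t] x u
        unfolding continuous_on_sequentially by (auto simp: o_def)
      then show "(\<lambda>n. g (u (n + N)) t) \<longlonglongrightarrow> g x t"
        by (rule LIMSEQ_ignore_initial_segment)
    qed
    show "AE t in M. norm (g (u (n + N)) t) \<le> g ?x t" for n
      using completely_monotone_antimono[OF cm x2 N] completely_monotone_nonneg[OF cm u(1)] by auto
  qed (use int x u x2 in auto)
  then show "((\<lambda>x. \<integral>t. g x t \<partial>M) \<circ> u) \<longlonglongrightarrow> (\<integral>t. g x t \<partial>M)"
    using LIMSEQ_offset[of "\<lambda>n. \<integral>t. g (u n) t \<partial>M"] by (simp add: o_def)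
qed

text \<open>The functions of this form, with \<open>g\<close> varying, are a closed family: minus a
  partial derivative moves under the integral sign and replaces \<open>g\<close> by minus its
  partial derivative.\<close>

lemma completely_monotone_integral:
  fixes g :: "real ^ 'n \<Rightarrow> 'w \<Rightarrow> real"
  assumes cm: "\<And>t. completely_monotone (\<lambda>x. g x t)"
    and int: "\<And>x. x \<in> pos_orthant \<Longrightarrow> integrable M (g x)"
  shows "completely_monotone (\<lambda>x. \<integral>t. g x t \<partial>M)"
proof -
  define F where "F = {f :: real ^ 'n \<Rightarrow> real. \<exists>g :: real ^ 'n \<Rightarrow> 'w \<Rightarrow> real.
      (\<forall>t. completely_monotone (\<lambda>x. g x t)) \<and>
    (\<forall>x\<in>pos_orthant. integrable M (g x)) \<and> f = (\<lambda>x. \<integral>t. g x t \<partial>M)}"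
  show ?thesis
  proof (rule completely_monotone_coinduct[where F = F])
    show "(\<lambda>x. \<integral>t. g x t \<partial>M) \<in> F"
      using assms by (auto simp: F_def)
  next
    fix f assume "f \<in> F"
    then obtain g where g: "\<And>t. completely_monotone (\<lambda>x. g x t)"
      "\<And>x. x \<in> pos_orthant \<Longrightarrow> integrable M (g x)" and f: "f = (\<lambda>x. \<integral>t. g x t \<partial>M)"
      by (auto simp: F_def)
    show "continuous_on pos_orthant f"
      unfolding f by (rule integral_continuous_on_orthant[OF g])
    show "0 \<le> f x" if "x \<in> pos_orthant" for x
      unfolding f using completely_monotone_nonneg[OF g(1) that] by simp
    fix i
    let ?g' = "\<lambda>x t. - partial i (\<lambda>x. g x t) x"
    have "(\<lambda>x. \<integral>t. ?g' x t \<partial>M) \<in> F"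
      unfolding F_def using completely_monotone_partial[OF g(1)] integral_partial(1)[OF g]
      by (intro CollectI exI[of _ ?g']) auto
    then show "\<exists>h\<in>F. \<forall>x\<in>pos_orthant.
        ((\<lambda>t. f (x + t *\<^sub>R axis i 1)) has_real_derivative - h x) (at 0)"
      using integral_partial(2)[OF g] by (intro bexI[of _ "\<lambda>x. \<integral>t. ?g' x t \<partial>M"]) (auto simp: f)
  qed
qed

section \<open>Gaussian and gamma integrals\<close>

lemma has_bochner_integral_gaussian_affine:
  fixes p c :: real
  assumes "0 < p"
  shows "has_bochner_integral lborel (\<lambda>t. exp (- (p * (t + c)\<^sup>2))) (sqrt (pi / p))"
proof -
  \<comment> \<open>With this standard deviation and mean \<open>- c\<close> the exponent of the
    normal density is exactly \<open>- (p * (t + c)\<^sup>2)\<close>, and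
    \<open>sqrt (pi / p)\<close> cancels its normalizing factor.\<close>
  define \<sigma> where "\<sigma> = 1 / sqrt (2 * p)"
  have \<sigma>2: "\<sigma>\<^sup>2 = 1 / (2 * p)"
    using assms by (simp add: \<sigma>_def power_divide)
  have "has_bochner_integral lborel (\<lambda>t. sqrt (pi / p) * normal_density (- c) \<sigma> t) (sqrt (pi / p)
      * 1)"
    by (intro has_bochner_integral_mult_right) (auto simp: has_bochner_integral_iff \<sigma>_def assms)
  moreover have "sqrt (pi / p) * normal_density (- c) \<sigma> t = exp (- (p * (t + c)\<^sup>2))" for t
    using assms by (simp add: normal_density_def \<sigma>2 field_simps)
  ultimately show ?thesis by simp
qed

text \<open>Lebesgue measure is translation invariant, so the integral over \<open>t\<close> does
  not see the shift \<open>c x\<close>, which may depend on \<open>x\<close> in any way. The value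
  is \<open>w x * sqrt (pi / p x)\<close>, and the constant is divided out.\<close>

lemma completely_monotone_gaussian_marginal:
  fixes w p :: "real ^ 'n \<Rightarrow> real"
  assumes p: "\<And>x. x \<in> pos_orthant \<Longrightarrow> 0 < p x"
    and cm: "\<And>t. completely_monotone (\<lambda>x. w x * exp (- (p x * (t + c x)\<^sup>2)))"
  shows "completely_monotone (\<lambda>x. w x * p x powr (- 1 / 2))"
proof -
  have hb: "has_bochner_integral lborel (\<lambda>t. w x * exp (- (p x * (t + c x)\<^sup>2))) (w x
      * sqrt (pi / p x))"
    if "x \<in> pos_orthant" for x
    by (intro has_bochner_integral_mult_right has_bochner_integral_gaussian_affine p that)
  have "completely_monotone (\<lambda>x. \<integral>t. w x * exp (- (p x * (t + c x)\<^sup>2)) \<partial>lborel)"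
    by (rule completely_monotone_integral[OF cm])
        (use hb in \<open>blast dest: has_bochner_integral_iff[THEN iffD1]\<close>)
  then have "completely_monotone (\<lambda>x. 1 / sqrt pi * (\<integral>t. w x * exp (- (p x * (t
      + c x)\<^sup>2)) \<partial>lborel))"
    by (intro completely_monotone_mult completely_monotone_const) auto
  then show ?thesis
  proof (rule completely_monotone_cong)
    fix x :: "real ^ 'n" assume x: "x \<in> pos_orthant"
    have "p x powr (- 1 / 2) = 1 / sqrt (p x)"
      using p[OF x] powr_minus_divide[of "p x" "1 / 2"] by (simp add: powr_half_sqrt)
    then show "1 / sqrt pi * (\<integral>t. w x * exp (- (p x * (t + c x)\<^sup>2)) \<partial>lborel)
        = w x * p x powr (- 1 / 2)"
      using has_bochner_integral_integral_eq[OF hb[OF x]] by (simp add: real_sqrt_divide)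
  qed
qed

text \<open>One real integration for each member of \<open>U\<close>. The variable integrated out is
  the value of \<open>\<zeta>\<close> at the new member, and \<open>w\<close> is generalized to
  absorb each factor \<open>p x powr (- 1 / 2)\<close>.\<close>

lemma completely_monotone_gaussian_marginals:
  fixes w p :: "real ^ 'n \<Rightarrow> real" and c :: "'u \<Rightarrow> real ^ 'n \<Rightarrow> real"
  assumes p: "\<And>x. x \<in> pos_orthant \<Longrightarrow> 0 < p x" and "finite U"
    and cm: "\<And>\<zeta>. completely_monotone (\<lambda>x. w x * exp (- (p x * (\<Sum>u\<in>U. (\<zeta> u + c u x)\<^sup>2))))"
  shows "completely_monotone (\<lambda>x. w x * p x powr (- real (card U) / 2))"
  using \<open>finite U\<close> cm
proof (induction U arbitrary: w)
  case empty
  show ?case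
    by (rule completely_monotone_cong[OF empty]) (use p in \<open>force\<close>)
next
  case (insert v U)
  have "completely_monotone (\<lambda>x. w x * p x powr (- 1 / 2) * exp (- (p x * (\<Sum>u\<in>U. (\<zeta> u
      + c u x)\<^sup>2))))"
    for \<zeta>
  proof -
    have "completely_monotone (\<lambda>x. w x * exp (- (p x * (\<Sum>u\<in>U. (\<zeta> u + c u x)\<^sup>2)))
        * p x powr (- 1 / 2))"
    proof (rule completely_monotone_gaussian_marginal[OF p])
      fix t
      have *: "(\<Sum>u\<in>insert v U. ((\<zeta>(v := t)) u + c u x)\<^sup>2)
          = (t + c v x)\<^sup>2 + (\<Sum>u\<in>U. (\<zeta> u + c u x)\<^sup>2)" for x
        using insert.hyps by (auto intro!: sum.cong)
      show "completely_monotone (\<lambda>x. w x * exp (- (p x * (\<Sum>u\<in>U. (\<zeta> u + c u x)\<^sup>2))) *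
          exp (- (p x * (t + c v x)\<^sup>2)))"
        using insert.prems[of "\<zeta>(v := t)"] unfolding *
        by (simp add: distrib_left mult.assoc add.commute flip: exp_add)
    qed
    then show ?thesis
      by (simp add: mult_ac)
  qed
  from insert.IH[OF this]
  show ?case
  proof (rule completely_monotone_cong)
    fix x :: "real ^ 'n" assume "x \<in> pos_orthant"
    have "- 1 / 2 + - real (card U) / 2 = - real (card (insert v U)) / 2"
      using insert.hyps by (simp add: field_simps)
    then show "w x * p x powr (- 1 / 2) * p x powr (- real (card U) / 2) =
        w x * p x powr (- real (card (insert v U)) / 2)"
      by (metis mult.assoc powr_add)
  qed
qed

text \<open>Euler's integral after the substitution of \<open>s * t\<close> for \<open>t\<close>;
  the factor \<open>s powr (1 - \<alpha>)\<close> removes the power of \<open>s\<close> that comes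
  out of the integrand.\<close>

lemma has_bochner_integral_Gamma:
  fixes s \<alpha> :: real
  assumes "0 < s" "0 < \<alpha>"
  shows "has_bochner_integral lborel (\<lambda>t. indicator {0..} t * t powr (\<alpha> - 1) * exp (- (t * s)))
    (Gamma \<alpha> * s powr (- \<alpha>))"
proof -
  define f where "f t = indicator {0..} t * t powr (\<alpha> - 1) * exp (- t)" for t :: real
  have f_meas: "f \<in> borel_measurable borel"
    unfolding f_def[abs_def] by measurable
  have "((\<lambda>t. t powr (\<alpha> - 1) / exp t) has_integral Gamma \<alpha>) {0..}"
    by (rule Gamma_integral_real[OF \<open>0 < \<alpha>\<close>])
  then have f_int: "(f has_integral Gamma \<alpha>) UNIV"
    unfolding has_integral_restrict_UNIV[of "{0..}", symmetric]
    by (rule has_integral_eq[rotated]) (auto simp: f_def exp_minus divide_inverse)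
  have f_nonneg: "0 \<le> f t" for t
    by (simp add: f_def)
  have "integral\<^sup>N lborel f = Gamma \<alpha>"
    by (rule nn_integral_has_integral_lborel[OF f_meas f_nonneg f_int])
  then have "has_bochner_integral lborel f (Gamma \<alpha>)"
    using \<open>0 < \<alpha>\<close> by (intro has_bochner_integral_nn_integral)
      (auto simp: f_meas f_nonneg intro!: less_imp_le Gamma_real_pos)
  then have "has_bochner_integral lborel (\<lambda>t. f (0 + s * t)) (Gamma \<alpha> /\<^sub>R \<bar>s\<bar>)"
    using \<open>0 < s\<close> by (subst (asm) lborel_has_bochner_integral_real_affine_iff[of s _ _ 0]) auto
  then have "has_bochner_integral lborel (\<lambda>t. s powr (1 - \<alpha>) * f (s * t)) (s powr (1 - \<alpha>)
      * (Gamma \<alpha> / s))"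
    using \<open>0 < s\<close> by (intro has_bochner_integral_mult_right) (simp add: divide_inverse mult.commute)
  moreover have "s powr (1 - \<alpha>) * f (s * t)
      = indicator {0..} t * t powr (\<alpha> - 1) * exp (- (t * s))" for t
  proof (cases "0 \<le> t")
    case True
    then show ?thesis
      using \<open>0 < s\<close> powr_add[of s "1 - \<alpha>" "\<alpha> - 1"] by (simp add: f_def powr_mult mult_ac)
  qed (use \<open>0 < s\<close> in \<open>auto simp: f_def indicator_def zero_le_mult_iff\<close>)
  moreover have "s powr (1 - \<alpha>) * (Gamma \<alpha> / s) = Gamma \<alpha> * s powr (- \<alpha>)"
  proof -
    have "s powr (1 - \<alpha>) = s * s powr (- \<alpha>)"
      using \<open>0 < s\<close> by (simp add: powr_diff powr_minus divide_inverse)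
    then show ?thesis using \<open>0 < s\<close> by simp
  qed
  ultimately show ?thesis by simp
qed

text \<open>For positive \<open>\<alpha>\<close>, the power \<open>p x powr (- \<alpha>)\<close> is
  the mixture of \<open>exp (- (t * p x))\<close> with density
  \<open>t powr (\<alpha> - 1) / Gamma \<alpha>\<close>. The density degenerates at
  \<open>\<alpha> = 0\<close>, where the hypothesis at \<open>t = 0\<close> already is the
  claim.\<close>

lemma completely_monotone_gamma_mixture:
  fixes w p :: "real ^ 'n \<Rightarrow> real"
  assumes p: "\<And>x. x \<in> pos_orthant \<Longrightarrow> 0 < p x" and "0 \<le> \<alpha>"
    and cm: "\<And>t. 0 \<le> t \<Longrightarrow> completely_monotone (\<lambda>x. w x * exp (- (t * p x)))"
  shows "completely_monotone (\<lambda>x. w x * p x powr (- \<alpha>))"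
proof (cases "\<alpha> = 0")
  case True
  show ?thesis
    by (rule completely_monotone_cong[OF cm[of 0]]) (use True p in force)+
next
  case False
  with \<open>0 \<le> \<alpha>\<close> have \<alpha>: "0 < \<alpha>" by simp
  define g where "g x t
      = indicator {0..} t * t powr (\<alpha> - 1) * (w x * exp (- (t * p x)))" for x and t :: real
  have hb: "has_bochner_integral lborel (g x) (w x * (Gamma \<alpha> * p x powr (- \<alpha>)))"
    if "x \<in> pos_orthant" for x
    using has_bochner_integral_mult_right[OF has_bochner_integral_Gamma[OF p[OF that] \<alpha>], of "w x"]
    by (simp add: g_def[abs_def] mult_ac)
  have "completely_monotone (\<lambda>x. g x t)" for t
  proof (cases "0 \<le> t")
    case True
    show ?thesis
      unfolding g_def by (intro completely_monotone_mult[OF completely_monotone_const] cm True) simp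
  qed (simp add: g_def completely_monotone_const)
  then have "completely_monotone (\<lambda>x. \<integral>t. g x t \<partial>lborel)"
    by (rule completely_monotone_integral)
        (use hb in \<open>blast dest: has_bochner_integral_iff[THEN iffD1]\<close>)
  then have "completely_monotone (\<lambda>x. 1 / Gamma \<alpha> * (\<integral>t. g x t \<partial>lborel))"
    using Gamma_real_pos[OF \<alpha>] by (intro completely_monotone_mult completely_monotone_const) auto
  then show ?thesis
    by (rule completely_monotone_cong)
      (use Gamma_real_pos[OF \<alpha>] has_bochner_integral_integral_eq[OF hb] in auto)
qed

section \<open>Determinants and elimination\<close>

text \<open>The Schur complement of entry \<open>k\<close>, \<open>k\<close>, kept on the full index
  type: for a nonzero pivot, row and column \<open>k\<close> become those of the identity because of
  the added \<open>1\<close>. The order of the factors matters for quaternions.\<close>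

definition eliminate :: "'m::finite \<Rightarrow> 'a::division_ring ^ 'm ^ 'm \<Rightarrow> 'a ^ 'm ^ 'm" where
  "eliminate k M = (\<chi> i j. M $ i $ j - M $ i $ k * inverse (M $ k $ k) * M $ k $ j
     + (if i = k \<and> j = k then 1 else 0))"

text \<open>Replaces the triangular determinant rule for matrices over an index type without an
  order.\<close>

lemma det_eq_prod_diag:
  fixes A :: "'a::comm_ring_1 ^ 'n::finite ^ 'n"
  assumes "\<And>p. p permutes UNIV \<Longrightarrow> p \<noteq> id \<Longrightarrow> \<exists>i. A $ i $ p i = 0"
  shows "det A = (\<Prod>i\<in>UNIV. A $ i $ i)"
proof -
  have "det A = (\<Sum>p\<in>{id}. of_int (sign p) * (\<Prod>i\<in>UNIV. A $ i $ p i))"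
    unfolding det_def
  proof (rule sum.mono_neutral_right)
    show "\<forall>p\<in>{p. p permutes UNIV} - {id}. of_int (sign p) * (\<Prod>i\<in>UNIV. A $ i $ p i) = 0"
    proof
      fix p :: "'n \<Rightarrow> 'n" assume "p \<in> {p. p permutes UNIV} - {id}"
      then obtain i where "A $ i $ p i = 0"
        using assms by blast
      then have "(\<Prod>i\<in>UNIV. A $ i $ p i) = 0"
        by (intro prod_zero) auto
      then show "of_int (sign p) * (\<Prod>i\<in>UNIV. A $ i $ p i) = 0" by simp
    qed
  qed (auto simp: permutes_id finite_permutations)
  then show ?thesis by simp
qed

definition replace_row :: "'n \<Rightarrow> ('n \<Rightarrow> 'a::semiring_1) \<Rightarrow> 'a ^ 'n::finite ^ 'n" where
  "replace_row k r = (\<chi> i j. if i = k then r j else if i = j then 1 else 0)"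

definition replace_col :: "'n \<Rightarrow> ('n \<Rightarrow> 'a::semiring_1) \<Rightarrow> 'a ^ 'n::finite ^ 'n" where
  "replace_col k c = (\<chi> i j. if j = k then c i else if i = j then 1 else 0)"

lemma transpose_replace_row: "transpose (replace_row k r) = replace_col k r"
  by (auto simp: transpose_def replace_row_def replace_col_def vec_eq_iff)

lemma mult_replace_row:
  "(X ** replace_row k r) $ i $ j = X $ i $ k * r j + (if j = k then 0 else X $ i $ j)"
proof -
  have "(X ** replace_row k r) $ i $ j
      = (\<Sum>a\<in>UNIV. (if a = k then X $ i $ k * r j else 0) + (if a = j then if j
          = k then 0 else X $ i $ j else 0))"
    unfolding matrix_matrix_mult_def vec_lambda_beta
        by (rule sum.cong) (simp_all add: replace_row_def)
  then show ?thesis by (simp add: sum.distrib)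
qed

lemma replace_col_mult:
  "(replace_col k c ** X) $ i $ j = c i * X $ k $ j + (if i = k then 0 else X $ i $ j)"
proof -
  have "(replace_col k c ** X) $ i $ j
      = (\<Sum>a\<in>UNIV. (if a = k then c i * X $ k $ j else 0) + (if a = i then if i
          = k then 0 else X $ i $ j else 0))"
    unfolding matrix_matrix_mult_def vec_lambda_beta
        by (rule sum.cong) (simp_all add: replace_col_def)
  then show ?thesis by (simp add: sum.distrib)
qed

lemma det_replace_row: "det (replace_row k r :: 'a::comm_ring_1 ^ 'n::finite ^ 'n) = r k"
proof -
  have "det (replace_row k r :: 'a ^ 'n ^ 'n) = (\<Prod>i\<in>UNIV. replace_row k r $ i $ i)"
  proof (rule det_eq_prod_diag)
    fix p :: "'n \<Rightarrow> 'n" assume p: "p permutes UNIV" "p \<noteq> id"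
    have "p = id" if *: "\<forall>i. i \<noteq> k \<longrightarrow> p i = i"
    proof (rule ext)
      fix i
      have "p k = k"
      proof (rule ccontr)
        assume "p k \<noteq> k"
        then have "p (p k) = p k" using * by simp
        then show False
          using \<open>p k \<noteq> k\<close> injD[OF permutes_inj[OF p(1)]] by simp
      qed
      then show "p i = id i" using * by (cases "i = k") simp_all
    qed
    with p(2) obtain i where "i \<noteq> k" "p i \<noteq> i" by blast
    then have "(replace_row k r :: 'a ^ 'n ^ 'n) $ i $ p i = 0"
      by (simp add: replace_row_def)
    then show "\<exists>i. (replace_row k r :: 'a ^ 'n ^ 'n) $ i $ p i = 0" ..
  qed
  also have "\<dots> = (\<Prod>i\<in>UNIV. if i = k then r k else 1)"
    by (rule prod.cong) (simp_all add: replace_row_def)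
  finally show ?thesis by simp
qed

lemma det_replace_col: "det (replace_col k c :: 'a::comm_ring_1 ^ 'n::finite ^ 'n) = c k"
  using det_replace_row[of k c] by (metis det_transpose transpose_replace_row)

text \<open>\<open>M\<close> factors as a column replacement with column \<open>k\<close> of
  \<open>M\<close>, then \<open>eliminate k M\<close>, then a row replacement with row
  \<open>k\<close> of \<open>M\<close> divided by the pivot. The outer factors have determinants
  \<open>M $ k $ k\<close> and \<open>1\<close>.\<close>

lemma det_eliminate:
  fixes M :: "'a::field ^ 'n::finite ^ 'n"
  assumes "M $ k $ k \<noteq> 0"
  shows "det M = M $ k $ k * det (eliminate k M)"
proof -
  have "M = replace_col k (\<lambda>i. M $ i $ k) ** (eliminate k M ** replace_row k (\<lambda>j. inverse
      (M $ k $ k) * M $ k $ j))"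
    using assms by (auto simp: vec_eq_iff replace_col_mult mult_replace_row eliminate_def)
  then have "det M = det (replace_col k (\<lambda>i. M $ i $ k) ** (eliminate k M ** replace_row k
      (\<lambda>j. inverse (M $ k $ k) * M $ k $ j)))"
    by (rule arg_cong)
  then show ?thesis
    using assms by (simp add: det_mul det_replace_col det_replace_row)
qed

section \<open>The Pfaffian\<close>

text \<open>An unnormalized Pfaffian. Summing over all permutations instead of over perfect
  matchings counts each matching repeatedly on antisymmetric matrices; dividing by the value at
  \<open>J_mat\<close> will correct this without computing the multiplicity.\<close>

definition pf_sum :: "complex ^ ('m::finite + 'm) ^ ('m + 'm) \<Rightarrow> complex" where
  "pf_sum Y = (\<Sum>p | p permutes UNIV. of_int (sign p) * (\<Prod>i\<in>UNIV. Y $ p (Inl i) $ p (Inr i)))"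

lemma prod_UNIV_sum_type:
  fixes h :: "'m::finite + 'k::finite \<Rightarrow> 'a::comm_monoid_mult"
  shows "(\<Prod>a\<in>UNIV. h a) = (\<Prod>i\<in>UNIV. h (Inl i)) * (\<Prod>i\<in>UNIV. h (Inr i))"
  by (simp add: prod.Plus flip: UNIV_Plus_UNIV)

lemma sum_UNIV_sum_type:
  fixes h :: "'m::finite + 'k::finite \<Rightarrow> 'a::comm_monoid_add"
  shows "(\<Sum>a\<in>UNIV. h a) = (\<Sum>i\<in>UNIV. h (Inl i)) + (\<Sum>i\<in>UNIV. h (Inr i))"
  by (simp add: sum.Plus flip: UNIV_Plus_UNIV)

lemma det_select_rows:
  fixes B :: "'a::comm_ring_1 ^ 'n::finite ^ 'n"
  shows "det (\<chi> a. B $ f a) = (if f permutes UNIV then of_int (sign f) * det B else 0)"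
proof (cases "f permutes UNIV")
  case True
  then show ?thesis by (simp add: det_permute_rows)
next
  case False
  then have "\<not> inj f"
    by (simp add: permutes_def bij_def finite_UNIV_inj_surj flip: bij_iff)
  then obtain a b where "f a = f b" "a \<noteq> b"
    unfolding inj_def by blast
  then have "row a (\<chi> a. B $ f a) = row b (\<chi> a. B $ f a)"
    by (simp add: row_def)
  then show ?thesis
    using det_identical_rows[OF \<open>a \<noteq> b\<close>] False by simp
qed

text \<open>As in the proof that determinants multiply: expanding the entries gives a sum over all
  maps \<open>f\<close> that select rows of \<open>B\<close>. The inner sum over permutations is the
  determinant of the selected rows, which vanishes unless \<open>f\<close> is a permutation and
  otherwise is \<open>sign f\<close> times \<open>det B\<close>.\<close>

lemma pf_sum_congruence:
  fixes B Y :: "complex ^ ('m::finite + 'm) ^ ('m + 'm)"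
  shows "pf_sum (transpose B ** Y ** B) = det B * pf_sum Y"
proof -
  let ?P = "{p :: 'm + 'm \<Rightarrow> 'm + 'm. p permutes UNIV}"
  have entry: "(transpose B ** Y ** B) $ a $ b
      = (\<Sum>(c, d)\<in>UNIV. B $ c $ a * Y $ c $ d * B $ d $ b)" for a b
  proof -
    have "(transpose B ** Y ** B) $ a $ b = (\<Sum>d\<in>UNIV. \<Sum>c\<in>UNIV. B $ c $ a * Y $ c $ d * B $ d $ b)"
      by (simp add: matrix_matrix_mult_def transpose_def sum_distrib_right)
    then show ?thesis
      by (subst (asm) sum.swap) (simp add: sum.cartesian_product)
  qed
  have expand: "(\<Prod>i\<in>UNIV. (transpose B ** Y ** B) $ p (Inl i) $ p (Inr i)) =
    (\<Sum>f\<in>UNIV. (\<Prod>i\<in>UNIV. Y $ f (Inl i) $ f (Inr i)) * (\<Prod>a\<in>UNIV. B $ f a $ p a))"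
        for p :: "'m + 'm \<Rightarrow> 'm + 'm"
  proof -
    have "(\<Prod>i\<in>UNIV. (transpose B ** Y ** B) $ p (Inl i) $ p (Inr i)) =
      (\<Sum>g\<in>PiE UNIV (\<lambda>_. UNIV). \<Prod>i\<in>UNIV. (case g i of (c, d) \<Rightarrow> B $ c $ p (Inl i) * Y $ c $ d
          * B $ d $ p (Inr i)))"
      unfolding entry by (rule prod_sum_PiE) auto
    also have "\<dots> = (\<Sum>f\<in>UNIV. \<Prod>i\<in>UNIV. B $ f (Inl i) $ p (Inl i) * Y $ f (Inl i) $ f (Inr i)
        * B $ f (Inr i) $ p (Inr i))"
      \<comment> \<open>A choice of an index pair for each \<open>i\<close> is the same as one map
        \<open>f\<close> on the sum type.\<close>
      by (rule sum.reindex_bij_witness[where i = "\<lambda>f i. (f (Inl i), f (Inr i))"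
            and j = "\<lambda>g. case_sum (fst \<circ> g) (snd \<circ> g)"])
        (auto simp: fun_eq_iff split_beta split: sum.split)
    finally show ?thesis
      by (simp add: prod_UNIV_sum_type prod.distrib mult_ac)
  qed
  have "pf_sum (transpose B ** Y ** B) = (\<Sum>p\<in>?P. \<Sum>f\<in>UNIV.
      (\<Prod>i\<in>UNIV. Y $ f (Inl i) $ f (Inr i)) * (of_int (sign p) * (\<Prod>a\<in>UNIV. B $ f a $ p a)))"
    unfolding pf_sum_def expand by (simp add: sum_distrib_left mult_ac)
  also have "\<dots> = (\<Sum>f\<in>UNIV. (\<Prod>i\<in>UNIV. Y $ f (Inl i) $ f (Inr i)) * det (\<chi> a. B $ f a))"
    by (subst sum.swap) (simp add: det_def sum_distrib_left)
  also have "\<dots> = (\<Sum>f\<in>UNIV. if f permutes UNIV then det B * (of_int (sign f)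
      * (\<Prod>i\<in>UNIV. Y $ f (Inl i) $ f (Inr i))) else 0)"
    unfolding det_select_rows by (intro sum.cong) (auto simp: mult_ac)
  also have "\<dots> = det B * pf_sum Y"
    unfolding pf_sum_def sum_distrib_left by (simp flip: sum.inter_filter add: sum.If_cases)
  finally show ?thesis .
qed

lemma antisymmetric_congruence:
  assumes "antisymmetric Y"
  shows "antisymmetric (transpose B ** Y ** B)"
proof -
  have "transpose (transpose B ** Y ** B) = transpose B ** transpose Y ** B"
    by (simp add: matrix_transpose_mul matrix_mul_assoc)
  also have "transpose Y = - Y"
    using assms by (simp add: antisymmetric_def)
  finally show ?thesis
    by (simp add: antisymmetric_def matrix_matrix_mult_def vec_eq_iff sum_negf)
qed

section \<open>The matrix \<open>J_mat\<close> and its value under \<open>pf_sum\<close>\<close>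

lemma J_mat_simps [simp]:
  "J_mat $ Inl i $ Inl j = 0" "J_mat $ Inr i $ Inr j = 0"
  "J_mat $ Inl i $ Inr j = (if i = j then 1 else 0)"
  "J_mat $ Inr i $ Inl j = (if i = j then - 1 else 0)"
  by (simp_all add: J_mat_def block_matrix_def mat_def)

lemma J_mat_off_diagonal: "case_sum id id a \<noteq> case_sum id id b \<Longrightarrow> J_mat $ a $ b = 0"
  by (cases a; cases b) auto

lemma J_mat_square: "J_mat ** J_mat = (- mat 1 :: complex ^ ('m::finite + 'm) ^ ('m + 'm))"
proof -
  have "(J_mat ** J_mat) $ a $ b = (- mat 1 :: complex ^ ('m + 'm) ^ ('m + 'm)) $ a $ b" for a b
    unfolding matrix_matrix_mult_def vec_lambda_beta sum_UNIV_sum_type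
    by (cases a; cases b) (auto simp: mat_def if_distrib[of
        "\<lambda>x. x * _"] if_distrib[of uminus] cong: if_cong)
  then show ?thesis by (simp add: vec_eq_iff)
qed

lemma transpose_J_mat: "transpose J_mat = - J_mat"
  using antisymmetric_J_mat by (simp add: antisymmetric_def)

text \<open>\<open>T = 1 + J\<close> satisfies \<open>T T = 2 J\<close> and \<open>T\<^sup>T T = 2\<close>.\<close>
lemma det_J_mat: "det (J_mat :: complex ^ ('m::finite + 'm) ^ ('m + 'm)) = 1"
proof -
  let ?J = "J_mat :: complex ^ ('m + 'm) ^ ('m + 'm)"
  have rdistrib: "(X + Y) ** Z = X ** Z + Y ** Z" for X Y Z :: "complex ^ ('m + 'm) ^ ('m + 'm)"
    by (simp add: matrix_matrix_mult_def vec_eq_iff distrib_right sum.distrib)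
  define T where "T = mat 1 + ?J"
  have neg: "(- X) ** Z = - (X ** Z)" for X Z :: "complex ^ ('m + 'm) ^ ('m + 'm)"
    by (simp add: matrix_matrix_mult_def vec_eq_iff sum_negf)
  have two: "mat 2 ** X = X + X" for X :: "complex ^ ('m + 'm) ^ ('m + 'm)"
    by (simp add: matrix_matrix_mult_def vec_eq_iff mat_def if_distrib[of
        "\<lambda>x. x * _"] cong: if_cong)
  have "T ** T = mat 2 ** ?J"
    unfolding two by (simp add: T_def matrix_add_ldistrib rdistrib J_mat_square)
  moreover have "transpose T ** T = mat 2"
  proof -
    have "transpose T = mat 1 - ?J"
    proof -
      have "transpose (mat 1 + X) = mat 1 + transpose X" for X :: "complex ^ ('m + 'm) ^ ('m + 'm)"
        by (auto simp: transpose_def vec_eq_iff mat_def)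
      then show ?thesis by (simp add: T_def transpose_J_mat)
    qed
    then have "transpose T ** T = (mat 1 + - ?J) ** (mat 1 + ?J)"
      by (simp add: T_def)
    also have "\<dots> = mat 1 + mat 1"
      by (simp only: matrix_add_ldistrib rdistrib neg J_mat_square matrix_mul_lid matrix_mul_rid)
          simp
    also have "\<dots> = mat 2"
      by (simp add: mat_def vec_eq_iff)
    finally show ?thesis .
  qed
  ultimately have "det (mat 2 :: complex ^ ('m + 'm) ^ ('m + 'm)) * det ?J
      = det (mat 2 :: complex ^ ('m + 'm) ^ ('m + 'm))"
    by (metis det_mul det_transpose)
  moreover have "det (mat 2 :: complex ^ ('m + 'm) ^ ('m + 'm)) \<noteq> 0"
    by (subst det_diagonal) (auto simp: mat_def)
  ultimately show ?thesis by simp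
qed

text \<open>Each transposition acts on the two copies as two disjoint transpositions, so the sign is
  unchanged at every step of the induction.\<close>

lemma sign_map_sum_diagonal:
  fixes p :: "'m::finite \<Rightarrow> 'm"
  assumes "p permutes UNIV"
  shows "map_sum p p permutes UNIV \<and> sign (map_sum p p) = 1"
  using assms finite
proof (induction p rule: permutes_induct)
  case id
  show ?case
    unfolding sum.map_id0 by (simp only: permutes_id sign_id)
next
  case (swap a b p)
  let ?t = "Transposition.transpose (Inl a) (Inl b :: 'm + 'm)"
  let ?u = "Transposition.transpose (Inr a) (Inr b :: 'm + 'm)"
  have eq: "map_sum (Transposition.transpose a b \<circ> p) (Transposition.transpose a b \<circ> p)
      = ?t \<circ> (?u \<circ> map_sum p p)"
  proof
    fix x :: "'m + 'm"
    show "map_sum (Transposition.transpose a b \<circ> p) (Transposition.transpose a b \<circ> p) x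
        = (?t \<circ> (?u \<circ> map_sum p p)) x"
      by (cases x) (simp_all add: Transposition.transpose_def)
  qed
  have p: "map_sum p p permutes UNIV" "sign (map_sum p p) = 1"
    using swap.IH by blast+
  have perm: "permutation ?t" "permutation ?u" "permutation (map_sum p p)"
    using permutes_imp_permutation[OF finite p(1)] by (simp_all only: permutation_swap_id)
  have "sign ?t = - 1" "sign ?u = - 1"
    using \<open>a \<noteq> b\<close> by (simp_all add: sign_swap_id)
  then have "sign (?t \<circ> (?u \<circ> map_sum p p)) = 1"
    by (simp add: sign_compose[OF perm(1) permutation_compose[OF perm(2,3)]] sign_compose[OF
        perm(2,3)] p)
  moreover have "?t \<circ> (?u \<circ> map_sum p p) permutes UNIV"
    by (intro permutes_compose[OF permutes_compose[OF p(1)]] permutes_swap_id UNIV_I)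
  ultimately show ?case
    unfolding eq by (rule conjI[rotated])
qed

text \<open>A permutation that respects the pairs either preserves or flips each pair, and a flip changes
  both the sign and one entry of \<open>J\<close>.\<close>
lemma pf_sum_J_mat_term:
  fixes p :: "'m::finite + 'm \<Rightarrow> 'm + 'm"
  assumes "p permutes UNIV" and "\<And>i. J_mat $ p (Inl i) $ p (Inr i) \<noteq> 0"
  shows "of_int (sign p) * (\<Prod>i\<in>UNIV. J_mat $ p (Inl i) $ p (Inr i)) = 1"
  using assms
proof (induction "card {i. \<exists>k. p (Inl i) = Inr k}" arbitrary: p)
  case 0
  then have "\<nexists>k. p (Inl i) = Inr k" for i
    by simp
  then have "\<exists>k. p (Inl i) = Inl k" for i
    by (metis sum.exhaust)
  then obtain q where q: "\<And>i. p (Inl i) = Inl (q i)"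
    by metis
  have q': "p (Inr i) = Inr (q i)" for i
    using "0.prems"(2)[of i] q[of i] by (cases "p (Inr i)") (auto split: if_splits)
  have p: "p = map_sum q q"
  proof
    fix x show "p x = map_sum q q x"
      by (cases x) (simp_all add: q q')
  qed
  have "inj q"
    using permutes_inj[OF "0.prems"(1)] q by (metis injD injI sum.inject(1))
  then have q_perm: "q permutes UNIV"
    by (intro bij_imp_permutes) (auto simp: bij_def finite_UNIV_inj_surj)
  show ?case
    using sign_map_sum_diagonal[OF q_perm] by (simp add: p)
next
  case (Suc n)
  have "{i. \<exists>k. p (Inl i) = Inr k} \<noteq> {}"
    using Suc.hyps(2) by (intro notI) simp
  then obtain e k where e: "p (Inl e) = Inr k" by blast
  have e': "p (Inr e) = Inl k"
    using Suc.prems(2)[of e] e by (cases "p (Inr e)") (auto split: if_splits)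
  \<comment> \<open>Exchanging the two members of the flipped pair \<open>e\<close> before applying
    \<open>p\<close> removes one flip, which decreases the induction measure by one.\<close>
  define t where "t = Transposition.transpose (Inl e) (Inr e :: 'm + 'm)"
  define p' where "p' = p \<circ> t"
  have t: "t permutes UNIV" "sign t = - 1"
    by (simp_all add: t_def permutes_swap_id sign_swap_id)
  have p'_e: "p' (Inl e) = Inl k" "p' (Inr e) = Inr k"
    by (simp_all add: p'_def t_def e e')
  have p'_i: "p' (Inl i) = p (Inl i)" "p' (Inr i) = p (Inr i)" if "i \<noteq> e" for i
    using that by (simp_all add: p'_def t_def Transposition.transpose_def)
  have p': "p' permutes UNIV"
    unfolding p'_def by (rule permutes_compose[OF t(1) Suc.prems(1)])
  have "sign p' = - sign p"
  proof -
    have "permutation p" "permutation t"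
      using permutes_imp_permutation[OF finite Suc.prems(1)]
          by (simp_all only: t_def permutation_swap_id)
    then show ?thesis
      unfolding p'_def by (simp add: sign_compose t(2))
  qed
  have "{i. \<exists>k. p' (Inl i) = Inr k} = {i. \<exists>k. p (Inl i) = Inr k} - {e}"
  proof (intro set_eqI)
    fix i show "i \<in> {i. \<exists>k. p' (Inl i) = Inr k} \<longleftrightarrow> i \<in> {i. \<exists>k. p (Inl i) = Inr k} - {e}"
      by (cases "i = e") (simp_all add: p'_e p'_i)
  qed
  then have "n = card {i. \<exists>k. p' (Inl i) = Inr k}"
    using Suc.hyps(2) e by (simp add: card_Diff_singleton)
  moreover have "J_mat $ p' (Inl i) $ p' (Inr i) \<noteq> 0" for i
    using Suc.prems(2)[of i] by (cases "i = e") (simp_all add: p'_e p'_i)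
  ultimately have IH: "of_int (sign p') * (\<Prod>i\<in>UNIV. J_mat $ p' (Inl i) $ p' (Inr i)) = 1"
    by (intro Suc.hyps(1) p')
  have "(\<Prod>i\<in>UNIV. J_mat $ p' (Inl i) $ p' (Inr i))
      = (\<Prod>i\<in>UNIV - {e}. J_mat $ p' (Inl i) $ p' (Inr i))"
    by (subst prod.remove[of UNIV e]) (simp_all add: p'_e)
  also have "\<dots> = (\<Prod>i\<in>UNIV - {e}. J_mat $ p (Inl i) $ p (Inr i))"
    by (rule prod.cong) (simp_all add: p'_i)
  also have "\<dots> = - (\<Prod>i\<in>UNIV. J_mat $ p (Inl i) $ p (Inr i))"
    using prod.remove[of UNIV e "\<lambda>i. J_mat $ p (Inl i) $ p (Inr i) :: complex"] by (simp add: e e')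
  finally show ?case
    using IH \<open>sign p' = - sign p\<close> by simp
qed

text \<open>All nonzero terms equal \<open>1\<close>, so the sum counts the permutations in
  \<open>?S\<close>, and the identity is one of them.\<close>

lemma pf_sum_J_mat_nonzero: "pf_sum (J_mat :: complex ^ ('m::finite + 'm) ^ ('m + 'm)) \<noteq> 0"
proof -
  let ?S = "{p :: 'm + 'm \<Rightarrow> 'm + 'm. p permutes UNIV \<and> (\<forall>i. J_mat $ p (Inl i) $ p (Inr i) \<noteq> 0)}"
  have "pf_sum (J_mat :: complex ^ ('m + 'm) ^ ('m + 'm)) =
      (\<Sum>p\<in>?S. of_int (sign p) * (\<Prod>i\<in>UNIV. J_mat $ p (Inl i) $ p (Inr i)))"
    unfolding pf_sum_def
  proof (rule sum.mono_neutral_right)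
    show "\<forall>p\<in>{p. p permutes UNIV} - ?S. of_int (sign p) * (\<Prod>i\<in>UNIV. J_mat $ p (Inl i) $ p (Inr i))
        = (0 :: complex)"
    proof
      fix p :: "'m + 'm \<Rightarrow> 'm + 'm" assume "p \<in> {p. p permutes UNIV} - ?S"
      then obtain i where "J_mat $ p (Inl i) $ p (Inr i) = 0" by blast
      then have "(\<Prod>i\<in>UNIV. J_mat $ p (Inl i) $ p (Inr i)) = (0 :: complex)"
        by (intro prod_zero) auto
      then show "of_int (sign p) * (\<Prod>i\<in>UNIV. J_mat $ p (Inl i) $ p (Inr i)) = (0 :: complex)"
        by simp
    qed
  qed (auto simp: finite_permutations)
  also have "\<dots> = (\<Sum>p\<in>?S. 1)"
    by (rule sum.cong[OF refl], rule pf_sum_J_mat_term) auto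
  also have "\<dots> = of_nat (card ?S)"
    by simp
  finally have "pf_sum (J_mat :: complex ^ ('m + 'm) ^ ('m + 'm)) = of_nat (card ?S)" .
  moreover have "id \<in> ?S" by (simp add: permutes_id)
  moreover have "finite ?S" by simp
  ultimately show ?thesis
    by (simp only: of_nat_eq_0_iff card_0_eq) blast
qed

section \<open>The square of the permutation sum\<close>

lemma congruence_replace_row:
  "(transpose (replace_row k r) ** Y ** replace_row k r) $ i $ j =
    (r i * Y $ k $ k + (if i = k then 0 else Y $ i $ k)) * r j
    + (if j = k then 0 else r i * Y $ k $ j + (if i = k then 0 else Y $ i $ j))"
  by (simp add: transpose_replace_row replace_col_mult mult_replace_row)

lemma pf_sum_zero_row:
  fixes Y :: "complex ^ ('m::finite + 'm) ^ ('m + 'm)"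
  assumes "\<And>b. Y $ a $ b = 0" "\<And>b. Y $ b $ a = 0"
  shows "pf_sum Y = 0"
proof -
  have "(\<Prod>i\<in>UNIV. Y $ p (Inl i) $ p (Inr i))
      = 0" if p: "p permutes UNIV" for p :: "'m + 'm \<Rightarrow> 'm + 'm"
  proof -
    obtain c where c: "p c = a"
      using permutes_surj[OF p] by (metis surjD)
    have "\<exists>i. Y $ p (Inl i) $ p (Inr i) = 0"
      using c assms by (cases c) metis+
    then show ?thesis by (intro prod_zero) auto
  qed
  then show ?thesis
    unfolding pf_sum_def by (intro sum.neutral) simp
qed

text \<open>Both sides are multiplied by \<open>(det B)\<^sup>2\<close> under the congruence, so the
  identity can be pulled back along an invertible \<open>B\<close>.\<close>

lemma pf_sum_square_congruence:
  assumes "det B \<noteq> 0"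
    and "(pf_sum (transpose B ** Y ** B))\<^sup>2 = c * det (transpose B ** Y ** B)"
  shows "(pf_sum Y)\<^sup>2 = c * det Y"
proof -
  have "(det B)\<^sup>2 * (pf_sum Y)\<^sup>2 = (det B)\<^sup>2 * (c * det Y)"
    using assms(2) unfolding pf_sum_congruence det_mul det_transpose
    by (simp add: power_mult_distrib power2_eq_square mult_ac)
  then show ?thesis using assms(1) by simp
qed

lemma antisymmetricD: "antisymmetric Y \<Longrightarrow> Y $ j $ i = - Y $ i $ j"
  unfolding antisymmetric_iff by blast

text \<open>Symplectic elimination: the pairs outside \<open>R\<close> have already been brought into the form they
  have in \<open>J\<close>.\<close>
lemma pf_sum_square_aux:
  fixes Y :: "complex ^ ('m::finite + 'm) ^ ('m + 'm)"
  assumes "finite R" "antisymmetric Y"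
    and "\<And>c d. case_sum id id c \<notin> R \<Longrightarrow> Y $ c $ d = J_mat $ c $ d"
  shows "(pf_sum Y)\<^sup>2 = (pf_sum (J_mat :: complex ^ ('m + 'm) ^ ('m + 'm)))\<^sup>2 * det Y"
  using assms
proof (induction R arbitrary: Y)
  case empty
  then have "Y = J_mat" by (simp add: vec_eq_iff)
  then show ?case by (simp add: det_J_mat)
next
  case (insert j R)
  define a b :: "'m + 'm" where "a = Inl j" and "b = Inr j"
  have ab: "a \<noteq> b" "case_sum id id a = j" "case_sum id id b = j" "J_mat $ a $ b
      = 1" "J_mat $ b $ a = - 1"
    by (simp_all add: a_def b_def)
  have J_a: "J_mat $ a $ d = (if d = b then 1 else 0)" and J_b: "J_mat $ b $ d = (if d
      = a then - 1 else 0)" for d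
    by (cases d; auto simp: a_def b_def)+
  have idx: "case_sum id id c = j \<Longrightarrow> c = a \<or> c = b" for c
    by (cases c) (auto simp: a_def b_def)
  let ?good = "\<lambda>Y :: complex ^ ('m + 'm) ^ ('m + 'm).
    (pf_sum Y)\<^sup>2 = (pf_sum (J_mat :: complex ^ ('m + 'm) ^ ('m + 'm)))\<^sup>2 * det Y"
  have nonzero: "?good Y" if Y: "antisymmetric Y"
    "\<And>c d. case_sum id id c \<notin> insert j R \<Longrightarrow> Y $ c $ d = J_mat $ c $ d" and nz: "Y $ a $ b \<noteq> 0" for Y
  proof -
    \<comment> \<open>The congruence scales column \<open>b\<close> so that its entry in row
      \<open>a\<close> becomes \<open>1\<close>, and subtracts multiples of it to clear the rest of
      row \<open>a\<close>.\<close>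
    define r where "r d = (if d = b then 1 / Y $ a $ b else - Y $ a $ d / Y $ a $ b)" for d
    define Y1 where "Y1 = transpose (replace_row b r) ** Y ** replace_row b r"
    \<comment> \<open>Now entry \<open>b\<close>, \<open>a\<close> is \<open>- 1\<close>, so adding
      \<open>Y1 $ b $ d\<close> times column \<open>a\<close> to column \<open>d\<close> clears row
      \<open>b\<close>. Row \<open>a\<close> keeps its form because its entry at \<open>a\<close> is
      zero.\<close>
    define s where "s d = (if d = a then 1 else Y1 $ b $ d)" for d
    define Y2 where "Y2 = transpose (replace_row a s) ** Y1 ** replace_row a s"
    have as1: "antisymmetric Y1" unfolding Y1_def by (rule antisymmetric_congruence[OF Y(1)])
    have as2: "antisymmetric Y2" unfolding Y2_def by (rule antisymmetric_congruence[OF as1])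
    have diag: "Z $ c $ c = 0" if "antisymmetric Z" for Z :: "complex ^ ('m + 'm) ^ ('m + 'm)" and c
      using antisymmetricD[OF that, of c c] by simp
    have fin: "Y $ a $ c = 0" "Y $ c $ b = 0" "r c = 0" "c \<noteq> a" "c \<noteq> b"
      "J_mat $ c $ a = 0" "J_mat $ c $ b = 0" if "case_sum id id c \<notin> insert j R" for c
    proof -
      show "c \<noteq> a" "c \<noteq> b" using that ab by auto
      show J: "J_mat $ c $ a = 0" "J_mat $ c $ b = 0"
        by (rule J_mat_off_diagonal; use that ab in auto)+
      then show "Y $ a $ c = 0" "Y $ c $ b = 0"
        using Y(2)[OF that] antisymmetricD[OF Y(1), of a c] by simp_all
      then show "r c = 0" using \<open>c \<noteq> b\<close> by (simp add: r_def)
    qed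
    have Y1_a: "Y1 $ a $ d = J_mat $ a $ d" for d
      unfolding Y1_def congruence_replace_row J_a using nz ab diag[OF Y(1)] by (simp add: r_def)
    have Y1_c: "Y1 $ c $ d = J_mat $ c $ d" if "case_sum id id c \<notin> insert j R" for c d
      unfolding Y1_def congruence_replace_row using fin[OF that] Y(2)[OF that] by simp
    have Y1_ba: "Y1 $ b $ a = - 1"
      using antisymmetricD[OF as1, of b a] by (simp add: Y1_a ab)
    have Y2_b: "Y2 $ b $ d = J_mat $ b $ d" for d
      unfolding Y2_def congruence_replace_row J_b
      using ab diag[OF as1] Y1_ba by (auto simp: s_def)
    have Y2_a: "Y2 $ a $ d = J_mat $ a $ d" for d
      unfolding Y2_def congruence_replace_row J_a using diag[OF as1] ab
          by (simp add: s_def Y1_a J_a)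
    have Y2_c: "Y2 $ c $ d = J_mat $ c $ d" if "case_sum id id c \<notin> insert j R" for c d
    proof -
      have "s c = 0"
        using fin[OF that] antisymmetricD[OF as1, of b c] Y1_c[OF that] by (simp add: s_def)
      then show ?thesis
        unfolding Y2_def congruence_replace_row using fin[OF that] Y1_c[OF that] by simp
    qed
    have "Y2 $ c $ d = J_mat $ c $ d" if "case_sum id id c \<notin> R" for c d
      using that idx[of c] Y2_a Y2_b Y2_c by (cases "case_sum id id c = j") auto
    then have "?good Y2"
      by (rule insert.IH[OF as2])
    then have "?good Y1"
      unfolding Y2_def by (rule pf_sum_square_congruence[rotated]) (simp add: det_replace_row s_def)
    then show "?good Y"
      unfolding Y1_def by (rule pf_sum_square_congruence[rotated])
          (simp add: det_replace_row r_def nz)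
  qed
  \<comment> \<open>If row \<open>a\<close> vanishes, both sides are zero. If only entry
    \<open>a\<close>, \<open>b\<close> vanishes, a further congruence makes it nonzero.\<close>
  consider "\<And>d. Y $ a $ d = 0" | "Y $ a $ b \<noteq> 0" | q where "Y $ a $ b = 0" "Y $ a $ q \<noteq> 0"
    by blast
  then show ?case
  proof cases
    case 1
    then have "pf_sum Y = 0"
      using antisymmetricD[OF insert.prems(1), of _ a] by (intro pf_sum_zero_row[of _ a]) simp_all
    moreover have "det Y = 0"
      using 1 by (intro det_zero_row(1)[of a]) (simp add: row_def vec_eq_iff)
    ultimately show ?thesis by simp
  next
    case 2
    then show ?thesis using nonzero insert.prems by blast
  next
    case 3
    have "q \<noteq> a" "q \<noteq> b"
      using 3 antisymmetricD[OF insert.prems(1), of a a] by auto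
    \<comment> \<open>The congruence adds column \<open>q\<close> to column \<open>b\<close>, and
      likewise for the rows, so entry \<open>a\<close>, \<open>b\<close> becomes
      \<open>Y $ a $ q\<close>.\<close>
    define r :: "'m + 'm \<Rightarrow> complex" where "r d = (if d = q \<or> d = b then 1 else 0)" for d
    define Y0 where "Y0 = transpose (replace_row q r) ** Y ** replace_row q r"
    \<comment> \<open>Index \<open>q\<close> belongs to a pair not yet treated, so the congruence
      leaves the finished rows unchanged.\<close>
    have q: "case_sum id id q \<in> insert j R"
    proof (rule ccontr)
      assume *: "case_sum id id q \<notin> insert j R"
      then have "Y $ q $ a = 0"
        using insert.prems(2)[OF *] J_mat_off_diagonal[of q a] ab by auto
      then show False
        using 3 antisymmetricD[OF insert.prems(1), of a q] by simp
    qed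
    have "antisymmetric Y0"
      unfolding Y0_def by (rule antisymmetric_congruence[OF insert.prems(1)])
    moreover have "Y0 $ c $ d = J_mat $ c $ d" if c: "case_sum id id c \<notin> insert j R" for c d
    proof -
      have "c \<noteq> q" "c \<noteq> b" using c q ab by auto
      moreover have "J_mat $ c $ q = 0" "J_mat $ c $ b = 0"
        by (rule J_mat_off_diagonal; use c q ab in auto)+
      ultimately show ?thesis
        unfolding Y0_def congruence_replace_row using insert.prems(2)[OF c] by (auto simp: r_def)
    qed
    moreover have "Y0 $ a $ b \<noteq> 0"
      unfolding Y0_def congruence_replace_row using 3 \<open>q \<noteq> a\<close> \<open>q \<noteq> b\<close> ab by (simp add: r_def)
    ultimately have "?good Y0"
      by (rule nonzero)
    then show ?thesis
      unfolding Y0_def by (rule pf_sum_square_congruence[rotated]) (simp add: det_replace_row r_def)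
  qed
qed

section \<open>Identification with the Pfaffian\<close>

lemma entry_polynomial_sum:
  assumes "finite S" "\<And>s. s \<in> S \<Longrightarrow> entry_polynomial (f s)"
  shows "entry_polynomial (\<lambda>Y. \<Sum>s\<in>S. f s Y)"
  using assms by induction (simp_all add: entry_polynomial.intros(1,3))

lemma entry_polynomial_prod:
  assumes "finite S" "\<And>s. s \<in> S \<Longrightarrow> entry_polynomial (f s)"
  shows "entry_polynomial (\<lambda>Y. \<Prod>s\<in>S. f s Y)"
  using assms by induction (simp_all add: entry_polynomial.intros(1,4))

text \<open>With \<open>R = UNIV\<close> the elimination lemma applies to every antisymmetric
  matrix, and dividing by the value at \<open>J_mat\<close> turns its conclusion into the defining
  properties of the Pfaffian. By uniqueness, \<open>pfaffian\<close> then inherits the congruence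
  rule of \<open>pf_sum\<close>.\<close>

lemma pfaffian_polynomial_pf_sum:
  "pfaffian_polynomial (\<lambda>Y :: complex ^ ('m::finite + 'm) ^ ('m
      + 'm). inverse (pf_sum (J_mat :: complex ^ ('m + 'm) ^ ('m + 'm))) * pf_sum Y)"
  unfolding pfaffian_polynomial_def
proof (intro conjI allI impI)
  have "entry_polynomial (pf_sum :: complex ^ ('m + 'm) ^ ('m + 'm) \<Rightarrow> complex)"
    unfolding pf_sum_def
    by (intro entry_polynomial_sum entry_polynomial.intros(4) entry_polynomial_prod
        entry_polynomial.intros(1,2)) (simp_all add: finite_permutations)
  then show "entry_polynomial (\<lambda>Y :: complex ^ ('m + 'm) ^ ('m
      + 'm). inverse (pf_sum (J_mat :: complex ^ ('m + 'm) ^ ('m + 'm))) * pf_sum Y)"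
    by (rule entry_polynomial.intros(4)[OF entry_polynomial.intros(1)])
next
  fix Y :: "complex ^ ('m + 'm) ^ ('m + 'm)" assume "antisymmetric Y"
  then show "(inverse (pf_sum (J_mat :: complex ^ ('m + 'm) ^ ('m + 'm))) * pf_sum Y)\<^sup>2 = det Y"
    using pf_sum_square_aux[of UNIV Y] pf_sum_J_mat_nonzero[where 'm = 'm]
    by (simp add: power_mult_distrib power_inverse)
qed (simp add: pf_sum_J_mat_nonzero)

lemma pfaffian_congruence:
  assumes "antisymmetric Y"
  shows "pfaffian (transpose B ** Y ** B) = det B * pfaffian Y"
  unfolding pfaffian_eqI[OF pfaffian_polynomial_pf_sum assms]
    pfaffian_eqI[OF pfaffian_polynomial_pf_sum antisymmetric_congruence[OF assms]]
  by (simp add: pf_sum_congruence)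

lemma pfaffian_J_mat: "pfaffian J_mat = 1"
  unfolding pfaffian_eqI[OF pfaffian_polynomial_pf_sum antisymmetric_J_mat]
  by (simp add: pf_sum_J_mat_nonzero)

section \<open>The Moore determinant\<close>

definition quat_adjoint :: "quat ^ 'm ^ 'n \<Rightarrow> quat ^ 'n ^ 'm" where
  "quat_adjoint M = (\<chi> i j. qcnj (M $ j $ i))"

lemma qcnj_sel [simp]:
  "qRe (qcnj q) = qRe q" "qIm1 (qcnj q) = - qIm1 q" "qIm2 (qcnj q) = - qIm2 q" "qIm3 (qcnj q)
      = - qIm3 q"
  by (simp_all add: qcnj_def)

lemma quat_of_real_sel [simp]:
  "qRe (of_real r) = r" "qIm1 (of_real r) = 0" "qIm2 (of_real r) = 0" "qIm3 (of_real r) = 0"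
  by (simp_all add: of_real_def)

lemma quat_fst_simps [simp]:
  "quat_fst 0 = 0" "quat_fst 1 = 1" "quat_fst (of_real r) = of_real r" "quat_fst (p + q)
      = quat_fst p + quat_fst q"
  "quat_fst (qcnj q) = cnj (quat_fst q)"
  "quat_fst (p * q) = quat_fst p * quat_fst q - quat_snd p * cnj (quat_snd q)"
  by (simp_all add: quat_fst_def quat_snd_def complex_eq_iff)

lemma quat_snd_simps [simp]:
  "quat_snd 0 = 0" "quat_snd 1 = 0" "quat_snd (of_real r) = 0" "quat_snd (p + q)
      = quat_snd p + quat_snd q"
  "quat_snd (qcnj q) = - quat_snd q"
  "quat_snd (p * q) = quat_fst p * quat_snd q + quat_snd p * cnj (quat_fst q)"
  by (simp_all add: quat_fst_def quat_snd_def complex_eq_iff)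

lemma quat_fst_sum: "quat_fst (sum f S) = (\<Sum>i\<in>S. quat_fst (f i))"
  by (induction S rule: infinite_finite_induct) simp_all

lemma quat_snd_sum: "quat_snd (sum f S) = (\<Sum>i\<in>S. quat_snd (f i))"
  by (induction S rule: infinite_finite_induct) simp_all

lemma Psi_simps [simp]:
  "Psi M $ Inl i $ Inl j = quat_fst (M $ i $ j)" "Psi M $ Inl i $ Inr j = quat_snd (M $ i $ j)"
  "Psi M $ Inr i $ Inl j = - cnj (quat_snd (M $ i $ j))" "Psi M $ Inr i $ Inr j
      = cnj (quat_fst (M $ i $ j))"
  by (simp_all add: Psi_def block_matrix_def Let_def)

text \<open>The blocks encode
  \<open>(a + b j) (c + d j) = (a c - b cnj d) + (a d + b cnj c) j\<close>, which rests on
  \<open>j z = cnj z j\<close>.\<close>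

lemma Psi_mult: "Psi (M ** N) = Psi M ** Psi N"
proof -
  have "Psi (M ** N) $ a $ b = (Psi M ** Psi N) $ a $ b" for a b
    unfolding matrix_matrix_mult_def vec_lambda_beta sum_UNIV_sum_type
    by (cases a; cases b)
      (simp_all add: quat_fst_sum quat_snd_sum sum.distrib sum_subtractf sum_negf algebra_simps)
  then show ?thesis by (simp add: vec_eq_iff)
qed

lemma Psi_mat_1: "Psi (mat 1 :: quat ^ 'm ^ 'm)
    = (mat 1 :: complex ^ ('m::finite + 'm) ^ ('m + 'm))"
proof -
  have "Psi (mat 1 :: quat ^ 'm ^ 'm) $ a $ b = mat 1 $ a $ b" for a b
    by (cases a; cases b) (simp_all add: mat_def)
  then show ?thesis by (simp add: vec_eq_iff)
qed

lemma J_mat_mult: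
  "(J_mat ** X) $ Inl i $ b = X $ Inr i $ b" "(J_mat ** X) $ Inr i $ b = - X $ Inl i $ b"
  by (simp_all add: matrix_matrix_mult_def sum_UNIV_sum_type if_distrib[of
      "\<lambda>x. x * _"] cong: if_cong)

lemma mult_J_mat:
  "(X ** J_mat) $ a $ Inl j = - X $ a $ Inr j" "(X ** J_mat) $ a $ Inr j = X $ a $ Inl j"
  by (simp_all add: matrix_matrix_mult_def sum_UNIV_sum_type if_distrib[of
      "\<lambda>x. _ * x"] cong: if_cong)

text \<open>Moving \<open>J_mat\<close> past \<open>Psi\<close> turns a quaternionic adjoint into a
  complex transpose. Hermitian congruences thus become the transpose congruences that the Pfaffian
  respects.\<close>

lemma J_mat_Psi_adjoint: "J_mat ** Psi (quat_adjoint L) = transpose (Psi L) ** J_mat"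
proof -
  have "(J_mat ** Psi (quat_adjoint L)) $ a $ b = (transpose (Psi L) ** J_mat) $ a $ b" for a b
    by (cases a; cases b)
      (simp_all add: J_mat_mult mult_J_mat quat_adjoint_def transpose_def)
  then show ?thesis by (simp add: vec_eq_iff)
qed

lemma antisymmetric_J_mat_Psi:
  assumes "quat_adjoint M = M"
  shows "antisymmetric (J_mat ** Psi M)"
proof -
  have "transpose (J_mat ** Psi M) = transpose (Psi M) ** - J_mat"
    by (simp add: matrix_transpose_mul transpose_J_mat)
  also have "\<dots> = - (transpose (Psi M) ** J_mat)"
    by (simp add: matrix_matrix_mult_def vec_eq_iff sum_negf)
  also have "\<dots> = - (J_mat ** Psi M)"
    using J_mat_Psi_adjoint[of M] assms by simp
  finally show ?thesis by (simp add: antisymmetric_def)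
qed

section \<open>Congruence and elimination for the Moore determinant\<close>

lemma moore_det_congruence:
  assumes "quat_adjoint M = M"
  shows "moore_det (quat_adjoint L ** (M ** L)) = det (Psi L) * moore_det M"
proof -
  have "J_mat ** Psi (quat_adjoint L ** (M ** L))
      = (J_mat ** Psi (quat_adjoint L)) ** (Psi M ** Psi L)"
    by (simp add: Psi_mult matrix_mul_assoc)
  also have "\<dots> = transpose (Psi L) ** (J_mat ** Psi M) ** Psi L"
    by (simp add: J_mat_Psi_adjoint matrix_mul_assoc)
  finally show ?thesis
    unfolding moore_det_def using pfaffian_congruence[OF antisymmetric_J_mat_Psi[OF assms]] by simp
qed

lemma moore_det_mat_1: "moore_det (mat 1) = 1"
  by (simp add: moore_det_def Psi_mat_1 pfaffian_J_mat)

text \<open>All rows of the complex matrix other than the two copies of row \<open>k\<close> are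
  identity rows. A permutation other than the identity either moves another index, or exchanges the
  two copies of \<open>k\<close> and meets the second complex component of \<open>r k\<close>, which
  is zero because \<open>r k\<close> is real.\<close>

lemma det_Psi_replace_row:
  assumes "r k = of_real s"
  shows "det (Psi (replace_row k r)) = of_real (s\<^sup>2)"
proof -
  let ?A = "Psi (replace_row k r)"
  have "det ?A = (\<Prod>a\<in>UNIV. ?A $ a $ a)"
  proof (rule det_eq_prod_diag)
    fix p :: "'a + 'a \<Rightarrow> 'a + 'a" assume p: "p permutes UNIV" "p \<noteq> id"
    show "\<exists>a. ?A $ a $ p a = 0"
    proof (cases "\<exists>a. a \<noteq> Inl k \<and> a \<noteq> Inr k \<and> p a \<noteq> a")
      case True
      then obtain a where a: "a \<noteq> Inl k" "a \<noteq> Inr k" "p a \<noteq> a" by blast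
      then have "?A $ a $ p a = 0"
        by (cases a; cases "p a") (auto simp: replace_row_def)
      then show ?thesis ..
    next
      case False
      then have fix_p: "p a = a" if "a \<noteq> Inl k" "a \<noteq> Inr k" for a
        using that by blast
      have inj: "p a = p b \<Longrightarrow> a = b" for a b
        using permutes_inj[OF p(1)] by (rule injD)
      have k: "p a = Inl k \<or> p a = Inr k" if "a = Inl k \<or> a = Inr k" for a
      proof (rule ccontr)
        assume *: "\<not> ?thesis"
        then have "p (p a) = p a" by (intro fix_p) simp_all
        then have "p a = a" by (rule inj)
        with * that show False by auto
      qed
      have "p (Inl k) = Inr k"
      proof (rule ccontr)
        assume "p (Inl k) \<noteq> Inr k"
        then have l: "p (Inl k) = Inl k" using k[of "Inl k"] by blast
        then have "p (Inr k) \<noteq> Inl k" using inj[of "Inr k" "Inl k"] by auto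
        then have "p (Inr k) = Inr k" using k[of "Inr k"] by blast
        with l fix_p have "p a = id a" for a
          by (cases "a = Inl k \<or> a = Inr k") auto
        with p(2) show False by (simp add: fun_eq_iff)
      qed
      then have "?A $ Inl k $ p (Inl k) = 0"
        using assms by (simp add: replace_row_def)
      then show ?thesis ..
    qed
  qed
  also have "\<dots> = (\<Prod>i\<in>UNIV. if i = k then of_real s else 1) * (\<Prod>i\<in>UNIV. if i
      = k then of_real s else 1)"
    unfolding prod_UNIV_sum_type using assms
    by (intro arg_cong2[where f = "(*)"] prod.cong) (simp_all add: replace_row_def)
  finally show ?thesis by (simp add: power2_eq_square)
qed

text \<open>A congruence \<open>L* E L\<close> must split the pivot evenly: \<open>L\<close> is the
  identity with row \<open>k\<close> replaced by row \<open>k\<close> of \<open>M\<close> divided by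
  \<open>sqrt p\<close>. Its diagonal entry is the real number \<open>sqrt p\<close>, so
  \<open>det (Psi L) = p\<close>.\<close>

lemma moore_det_eliminate:
  fixes M :: "quat ^ 'm::finite ^ 'm"
  assumes M: "\<And>i j. qcnj (M $ j $ i) = M $ i $ j"
    and E: "\<And>i j. qcnj (eliminate k M $ j $ i) = eliminate k M $ i $ j"
    and p: "M $ k $ k = of_real p" "0 < p"
  shows "moore_det M = of_real p * moore_det (eliminate k M)"
proof -
  \<comment> \<open>Being real, \<open>c\<close> is central and fixed by conjugation, and its square
    is the inverse of the pivot.\<close>
  define c :: quat where "c = of_real (1 / sqrt p)"
  have c: "q * c = c * q" "qcnj c = c" for q
  proof -
    have "q * of_real r = of_real r * q" "qcnj (of_real r) = of_real r" for r
      by (simp_all add: quat_eq_iff)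
    then show "q * c = c * q" "qcnj c = c"
      unfolding c_def by blast+
  qed
  have qcnj_mult: "qcnj (q * q') = qcnj q' * qcnj q" for q q'
    by (simp add: quat_eq_iff algebra_simps)
  have cc: "c * c = inverse (M $ k $ k)"
  proof -
    have "c * c = of_real (1 / sqrt p * (1 / sqrt p))"
      by (simp only: c_def of_real_mult)
    also have "1 / sqrt p * (1 / sqrt p) = inverse p"
      using p(2) by (simp add: inverse_eq_divide)
    finally show ?thesis by (simp add: p)
  qed
  have nz: "M $ k $ k \<noteq> 0" using p by simp
  define L where "L = replace_row k (\<lambda>j. c * M $ k $ j)"
  have adj: "quat_adjoint L = replace_col k (\<lambda>i. M $ i $ k * c)"
  proof -
    have "qcnj 0 = 0" "qcnj 1 = 1"
      by (simp_all add: quat_eq_iff)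
    then show ?thesis
      using M by (simp add: quat_adjoint_def L_def replace_row_def replace_col_def vec_eq_iff
          qcnj_mult c(2))
  qed
  have E_k: "eliminate k M $ k $ j = (if j = k then 1 else 0)" "eliminate k M $ j $ k = (if j
      = k then 1 else 0)" for j
    using nz by (simp_all add: eliminate_def mult.assoc) (simp add: mult.assoc[symmetric])
  have "(quat_adjoint L ** (eliminate k M ** L)) $ i $ j = M $ i $ j" for i j
  proof -
    have "M $ i $ k * c * (c * M $ k $ j) = M $ i $ k * inverse (M $ k $ k) * M $ k $ j"
      by (simp only: mult.assoc flip: cc)
    moreover have "M $ k $ k * (inverse (M $ k $ k) * M $ k $ j) = M $ k $ j"
      using nz by (simp add: mult.assoc[symmetric])
    ultimately show ?thesis
      unfolding adj unfolding L_def replace_col_mult mult_replace_row E_k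
      using nz by (auto simp: eliminate_def mult.assoc)
  qed
  then have "M = quat_adjoint L ** (eliminate k M ** L)"
    by (simp add: vec_eq_iff)
  then have "moore_det M = moore_det (quat_adjoint L ** (eliminate k M ** L))"
    by (rule arg_cong)
  also have "\<dots> = det (Psi L) * moore_det (eliminate k M)"
    using E by (intro moore_det_congruence) (simp add: quat_adjoint_def vec_eq_iff)
  also have "det (Psi L) = of_real p"
  proof -
    have "c * M $ k $ k = of_real (sqrt p)"
    proof -
      have "1 / sqrt p * p = sqrt p"
        using p(2) real_div_sqrt[of p] by simp
      then show ?thesis
        unfolding c_def p(1) by (simp only: flip: of_real_mult)
    qed
    then have "det (Psi L) = of_real ((sqrt p)\<^sup>2)"
      unfolding L_def by (rule det_Psi_replace_row)
    then show ?thesis using p(2) by simp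
  qed
  finally show ?thesis .
qed

section \<open>Hermitian forms over real division algebras\<close>

text \<open>The common features of the reals, complex numbers and quaternions. \<open>units\<close>
  is an orthonormal basis over the reals for the inner product \<open>re (cj x * y)\<close>, with
  \<open>parseval\<close> expressing completeness; its cardinality is the real dimension of the
  scalars.\<close>

locale real_conjugation =
  fixes cj :: "'f::real_div_algebra \<Rightarrow> 'f" and re :: "'f \<Rightarrow> real" and units :: "'f set"
  assumes cj_add: "cj (x + y) = cj x + cj y"
    and cj_mult: "cj (x * y) = cj y * cj x"
    and cj_cj [simp]: "cj (cj x) = x"
    and cj_of_real [simp]: "cj (of_real r) = of_real r"
    and re_add: "re (x + y) = re x + re y"
    and re_scaleR: "re (r *\<^sub>R x) = r * re x"
    and re_one [simp]: "re 1 = 1"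
    and re_cj [simp]: "re (cj x) = re x"
    and of_real_re: "cj x = x \<Longrightarrow> of_real (re x) = x"
    and finite_units: "finite units"
    and parseval: "re (cj x * x) = (\<Sum>u\<in>units. (re (cj u * x))\<^sup>2)"
    and orthonormal: "u \<in> units \<Longrightarrow> v \<in> units \<Longrightarrow> re (cj u * v) = (if u = v then 1 else 0)"
begin

lemma cj_0 [simp]: "cj 0 = 0" and cj_1 [simp]: "cj 1 = 1"
  using cj_of_real[of 0] cj_of_real[of 1] by simp_all

lemma re_0 [simp]: "re 0 = 0"
  using re_scaleR[of 0 0] by simp

lemma re_of_real [simp]: "re (of_real r) = r"
  using re_scaleR[of r 1] by (simp add: of_real_def)

lemma cj_minus: "cj (- x) = - cj x"
  using cj_add[of x "- x"] by (simp add: eq_neg_iff_add_eq_0 add.commute)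

lemma cj_diff: "cj (x - y) = cj x - cj y"
  using cj_add[of x "- y"] by (simp add: cj_minus)

lemma re_diff: "re (x - y) = re x - re y"
  using re_add[of "x - y" y] by simp

lemma cj_scaleR: "cj (r *\<^sub>R x) = r *\<^sub>R cj x"
proof -
  have "cj (of_real r * x) = cj x * of_real r"
    by (simp only: cj_mult cj_of_real)
  then show ?thesis
    by (simp add: of_real_def)
qed

lemma cj_sum: "cj (sum f S) = (\<Sum>i\<in>S. cj (f i))"
  by (induction S rule: infinite_finite_induct) (simp_all add: cj_add)

lemma re_sum: "re (sum f S) = (\<Sum>i\<in>S. re (f i))"
  by (induction S rule: infinite_finite_induct) (simp_all add: re_add)

lemma re_mult_of_real: "re (x * of_real r) = r * re x" "re (of_real r * x) = r * re x"
  by (simp_all add: of_real_def re_scaleR)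

lemma cj_self_mult: "cj x * x = of_real (re (cj x * x))"
  by (rule of_real_re[symmetric]) (simp add: cj_mult)

lemma re_self_nonneg: "0 \<le> re (cj x * x)"
  by (simp add: parseval sum_nonneg)

lemma re_self_eq_0_iff: "re (cj x * x) = 0 \<longleftrightarrow> x = 0"
proof
  assume "re (cj x * x) = 0"
  then have "cj x * x = 0"
    using cj_self_mult[of x] by simp
  then show "x = 0"
    by (metis cj_0 cj_cj mult_eq_0_iff)
qed simp

section \<open>Hermitian forms and a single elimination step\<close>

definition hermitian :: "'f ^ 'm::finite ^ 'm \<Rightarrow> bool" where
  "hermitian M \<longleftrightarrow> (\<forall>i j. cj (M $ j $ i) = M $ i $ j)"

definition form :: "'f ^ 'm::finite ^ 'm \<Rightarrow> 'f ^ 'm \<Rightarrow> real" where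
  "form M v = re (\<Sum>i\<in>UNIV. cj (v $ i) * (M *v v) $ i)"

definition posdef :: "'f ^ 'm::finite ^ 'm \<Rightarrow> bool" where
  "posdef M \<longleftrightarrow> hermitian M \<and> (\<forall>v. v \<noteq> 0 \<longrightarrow> 0 < form M v)"

lemma hermitian_diag:
  assumes "hermitian M"
  shows "M $ k $ k = of_real (re (M $ k $ k))"
  using assms by (intro of_real_re[symmetric]) (simp add: hermitian_def)

lemma hermitian_eliminate:
  assumes "hermitian M"
  shows "hermitian (eliminate k M)"
proof -
  have "cj (inverse (M $ k $ k)) = inverse (M $ k $ k)"
    using hermitian_diag[OF assms, of k] by (metis cj_of_real of_real_inverse)
  then show ?thesis
    using assms by (auto simp: hermitian_def eliminate_def cj_add cj_diff cj_mult mult.assoc)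
qed

lemma form_eq_sum: "form M v = (\<Sum>i\<in>UNIV. \<Sum>j\<in>UNIV. re (cj (v $ i) * M $ i $ j * v $ j))"
  by (simp add: form_def matrix_vector_mult_def re_sum sum_distrib_left mult.assoc)

lemma form_scaleR_sum:
  "form (\<Sum>i\<in>S. c i *\<^sub>R A i) v = (\<Sum>i\<in>S. c i * form (A i) v)"
proof -
  have "form (\<Sum>i\<in>S. c i *\<^sub>R A i) v =
      (\<Sum>a\<in>UNIV. \<Sum>b\<in>UNIV. \<Sum>i\<in>S. c i * re (cj (v $ a) * A i $ a $ b * v $ b))"
    by (simp add: form_eq_sum sum_component sum_distrib_left sum_distrib_right re_sum re_scaleR)
  also have "\<dots> = (\<Sum>a\<in>UNIV. \<Sum>i\<in>S. \<Sum>b\<in>UNIV. c i * re (cj (v $ a) * A i $ a $ b * v $ b))"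
    by (intro sum.cong refl sum.swap)
  also have "\<dots> = (\<Sum>i\<in>S. \<Sum>a\<in>UNIV. \<Sum>b\<in>UNIV. c i * re (cj (v $ a) * A i $ a $ b * v $ b))"
    by (rule sum.swap)
  finally show ?thesis
    by (simp add: form_eq_sum sum_distrib_left)
qed

text \<open>For hermitian \<open>M\<close>, column \<open>k\<close> contributes the conjugate of
  \<open>(M *v v) $ k\<close>, so the term subtracted by elimination is a squared modulus divided by
  the pivot. The pivot is real and its inverse can be moved to the front. The last summand comes
  from the \<open>1\<close> placed at \<open>k\<close>, \<open>k\<close>.\<close>

lemma form_diff_eliminate:
  fixes M :: "'f ^ 'm::finite ^ 'm" and k :: 'm
  assumes M: "hermitian M"
  defines "p \<equiv> re (M $ k $ k)"
  shows "form (eliminate k M) v =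
    form M v - re (cj ((M *v v) $ k) * (M *v v) $ k) / p + re (cj (v $ k) * v $ k)"
proof -
  have inv: "inverse (M $ k $ k) = of_real (1 / p)"
    using hermitian_diag[OF M, of k] by (metis inverse_eq_divide of_real_inverse p_def)
  have "form (eliminate k M) v = form M v
      - (\<Sum>i\<in>UNIV. \<Sum>j\<in>UNIV. re (cj (v $ i) * (M $ i $ k * inverse (M $ k $ k) * M $ k $ j) * v $ j))
      + (\<Sum>i\<in>UNIV. \<Sum>j\<in>UNIV. re (cj (v $ i) * (if i = k \<and> j = k then 1 else 0) * v $ j))"
  proof -
    have "re (cj (v $ i) * eliminate k M $ i $ j * v $ j) = re (cj (v $ i) * M $ i $ j * v $ j)
        - re (cj (v $ i) * (M $ i $ k * inverse (M $ k $ k) * M $ k $ j) * v $ j)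
        + re (cj (v $ i) * (if i = k \<and> j = k then 1 else 0) * v $ j)" for i j
      by (simp only: eliminate_def vec_lambda_beta distrib_left distrib_right left_diff_distrib
          right_diff_distrib re_add re_diff)
    then show ?thesis
      unfolding form_eq_sum by (simp add: sum.distrib sum_subtractf)
  qed
  also have "(\<Sum>i\<in>UNIV. \<Sum>j\<in>UNIV. re (cj (v $ i) * (if i = k \<and> j = k then 1 else 0) * v $ j))
      = re (cj (v $ k) * v $ k)"
  proof -
    have "re (cj (v $ i) * (if i = k \<and> j = k then 1 else 0) * v $ j)
        = (if j = k then if i = k then re (cj (v $ k) * v $ k) else 0 else 0)" for i j
      by simp
    then show ?thesis by simp
  qed
  also have "(\<Sum>i\<in>UNIV. \<Sum>j\<in>UNIV. re (cj (v $ i) * (M $ i $ k * inverse (M $ k $ k) * M $ k $ j)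
      * v $ j))
      = re (cj ((M *v v) $ k) * (M *v v) $ k) / p"
  proof -
    have "cj ((M *v v) $ k) * (M *v v) $ k
        = (\<Sum>i\<in>UNIV. \<Sum>j\<in>UNIV. cj (v $ i) * M $ i $ k * (M $ k $ j * v $ j))"
      using M by (simp add: matrix_vector_mult_def cj_sum cj_mult sum_product hermitian_def)
    then have "re (cj ((M *v v) $ k) * (M *v v) $ k) / p
        = (\<Sum>i\<in>UNIV. \<Sum>j\<in>UNIV. re (cj (v $ i) * M $ i $ k * (M $ k $ j * v $ j)) / p)"
      by (simp add: re_sum sum_divide_distrib)
    moreover have "re (cj (v $ i) * (M $ i $ k * inverse (M $ k $ k) * M $ k $ j) * v $ j)
        = re (cj (v $ i) * M $ i $ k * (M $ k $ j * v $ j)) / p" for i j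
    proof -
      have "cj (v $ i) * (M $ i $ k * of_real (1 / p) * M $ k $ j) * v $ j
          = (1 / p) *\<^sub>R (cj (v $ i) * M $ i $ k * (M $ k $ j * v $ j))"
        by (simp add: of_real_def mult.assoc)
      then show ?thesis
        by (simp add: inv re_scaleR)
    qed
    ultimately show ?thesis by simp
  qed
  finally show ?thesis .
qed

lemma eliminate_row_col:
  assumes "M $ k $ k \<noteq> 0"
  shows "eliminate k M $ k $ j = (if j = k then 1 else 0)"
    and "eliminate k M $ j $ k = (if j = k then 1 else 0)"
  using assms by (simp_all add: eliminate_def mult.assoc) (simp add: mult.assoc[symmetric])

text \<open>Row and column \<open>k\<close> of the eliminated matrix are those of the identity, so
  after removal of the square of coordinate \<open>k\<close> the form no longer involves that
  coordinate.\<close>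

lemma form_eliminate_shift:
  assumes "M $ k $ k \<noteq> 0"
  shows "form (eliminate k M) (v + axis k z) - re (cj ((v + axis k z) $ k) * (v + axis k z) $ k)
    = form (eliminate k M) v - re (cj (v $ k) * v $ k)"
proof -
  have *: "form (eliminate k M) w - re (cj (w $ k) * w $ k) =
      (\<Sum>i\<in>-{k}. \<Sum>j\<in>-{k}. re (cj (w $ i) * eliminate k M $ i $ j * w $ j))" for w
  proof -
    let ?f = "\<lambda>i j. re (cj (w $ i) * eliminate k M $ i $ j * w $ j)"
    have split: "sum g UNIV = g k + sum g (- {k})" for g :: "'a \<Rightarrow> real"
      by (simp add: sum.remove[of UNIV k] Compl_eq_Diff_UNIV)
    have "sum (?f k) (- {k}) = 0"
      by (intro sum.neutral) (auto simp: eliminate_row_col[of M, OF assms])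
    moreover have "sum (?f i) UNIV = sum (?f i) (- {k})" if "i \<noteq> k" for i
      unfolding split using that by (simp add: eliminate_row_col[of M, OF assms])
    ultimately show ?thesis
      unfolding form_eq_sum split[of "\<lambda>i. sum (?f i) UNIV"]
      unfolding split[of "?f k"] by (simp add: eliminate_row_col[of M, OF assms])
  qed
  show ?thesis
    unfolding * by (intro sum.cong refl) (simp add: axis_def)
qed

lemma posdef_pivot:
  assumes "posdef M"
  shows "0 < re (M $ k $ k)"
proof -
  have "form M (axis k 1) = re (M $ k $ k)"
  proof -
    have "re (cj (axis k 1 $ i) * M $ i $ j * axis k 1 $ j)
        = (if j = k then if i = k then re (M $ k $ k) else 0 else 0)" for i j
      by (simp add: axis_def)
    then show ?thesis by (simp add: form_eq_sum)
  qed
  moreover have "axis k (1 :: 'f) \<noteq> 0"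
    by (simp add: vec_eq_iff axis_def)
  ultimately show ?thesis
    using assms unfolding posdef_def by metis
qed

lemma posdef_pivot_nz: "posdef M \<Longrightarrow> M $ k $ k \<noteq> 0"
  using posdef_pivot[of M k] by auto

lemma mult_add_axis: "(M *v (v + axis k z)) $ i = (M *v v) $ i + M $ i $ k * z"
proof -
  have "(\<Sum>j\<in>UNIV. M $ i $ j * axis k z $ j) = M $ i $ k * z"
    by (simp add: axis_def if_distrib[of "\<lambda>x. _ * x"] cong: if_cong)
  then show ?thesis
    by (simp add: matrix_vector_mult_def distrib_left sum.distrib)
qed

lemma posdef_eliminate:
  assumes M: "posdef M"
  shows "posdef (eliminate k M)"
  unfolding posdef_def
proof (intro conjI allI impI)
  from M have herm: "hermitian M" by (simp add: posdef_def)
  then show "hermitian (eliminate k M)" by (rule hermitian_eliminate)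
  fix v :: "'f ^ 'a" assume "v \<noteq> 0"
  \<comment> \<open>The value for the change of coordinate \<open>k\<close> that makes component
    \<open>k\<close> of \<open>M *v w\<close> vanish. The eliminated form at \<open>v\<close> then
    equals the form of \<open>M\<close> at \<open>w\<close> plus the square of \<open>v $ k\<close>.
    If \<open>w = 0\<close>, then \<open>v\<close> lives in coordinate \<open>k\<close> alone and
    the second term is positive.\<close>
  define z where "z = - (inverse (M $ k $ k) * (M *v v) $ k)"
  define w where "w = v + axis k z"
  have "(M *v w) $ k = 0"
    unfolding w_def mult_add_axis z_def using posdef_pivot_nz[OF M, of k] by (simp flip: mult.assoc)
  then have "form M w = form (eliminate k M) w - re (cj (w $ k) * w $ k)"
    using form_diff_eliminate[OF herm, of k w] by simp
  also have "\<dots> = form (eliminate k M) v - re (cj (v $ k) * v $ k)"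
    unfolding w_def by (rule form_eliminate_shift[OF posdef_pivot_nz[OF M]])
  finally have eq: "form (eliminate k M) v = form M w + re (cj (v $ k) * v $ k)" by simp
  show "0 < form (eliminate k M) v"
  proof (cases "w = 0")
    case True
    have "v $ i = 0" if "i \<noteq> k" for i
    proof -
      have "w $ i = v $ i" using that by (simp add: w_def axis_def)
      then show ?thesis using True by simp
    qed
    then have "v $ k \<noteq> 0"
      using \<open>v \<noteq> 0\<close> by (metis vec_eq_iff zero_index)
    then have "re (cj (v $ k) * v $ k) \<noteq> 0"
      by (simp add: re_self_eq_0_iff)
    then have "0 < re (cj (v $ k) * v $ k)"
      using re_self_nonneg[of "v $ k"] by linarith
    then show ?thesis
      using eq True by (simp add: form_def)
  next
    case False
    then have "0 < form M w"
      using M by (simp add: posdef_def)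
    then show ?thesis
      using eq re_self_nonneg[of "v $ k"] by linarith
  qed
qed

text \<open>With \<open>b = (M *v v) $ k\<close> and \<open>z\<close> the value put into coordinate
  \<open>k\<close>, the form exceeds the eliminated form by the square of
  \<open>b + p *\<^sub>R z\<close> divided by \<open>p\<close>. \<open>parseval\<close> splits this
  into real squares, one for each real coordinate \<open>\<zeta> u\<close> of
  \<open>z\<close>.\<close>

lemma form_complete_square:
  fixes M :: "'f ^ 'm::finite ^ 'm" and k :: 'm
  assumes M: "posdef M" and v: "v $ k = 0"
  defines "p \<equiv> re (M $ k $ k)"
  shows "form M (v + axis k (\<Sum>u\<in>units. \<zeta> u *\<^sub>R u)) = form (eliminate k M) v
    + p * (\<Sum>u\<in>units. (\<zeta> u + re (cj u * (M *v v) $ k) / p)\<^sup>2)"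
proof -
  define z where "z = (\<Sum>u\<in>units. \<zeta> u *\<^sub>R u)"
  define b where "b = (M *v v) $ k"
  have herm: "hermitian M" using M by (simp add: posdef_def)
  have p: "0 < p" unfolding p_def by (rule posdef_pivot[OF M])
  have Mkk: "M $ k $ k = of_real p"
    unfolding p_def by (rule hermitian_diag[OF herm])
  have z: "re (cj u * z) = \<zeta> u" if "u \<in> units" for u
  proof -
    have "re (cj u * z) = (\<Sum>u'\<in>units. \<zeta> u' * re (cj u * u'))"
      by (simp add: z_def sum_distrib_left re_sum re_scaleR)
    also have "\<dots> = (\<Sum>u'\<in>units. if u' = u then \<zeta> u else 0)"
      by (intro sum.cong refl) (simp add: orthonormal that)
    finally show ?thesis using that finite_units by simp
  qed
  have "form M (v + axis k z) = form (eliminate k M) v + re (cj (b + p *\<^sub>R z) * (b + p *\<^sub>R z)) / p"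
    using form_diff_eliminate[OF herm, of k "v + axis k z"]
      form_eliminate_shift[OF posdef_pivot_nz[OF M], of k v z] v
    unfolding mult_add_axis Mkk by (simp add: b_def p_def scaleR_conv_of_real)
  also have "re (cj (b + p *\<^sub>R z) * (b + p *\<^sub>R z)) / p
      = p * (\<Sum>u\<in>units. (\<zeta> u + re (cj u * b) / p)\<^sup>2)"
  proof -
    have "(re (cj u * (b + p *\<^sub>R z)))\<^sup>2 / p = p * (\<zeta> u + re (cj u * b) / p)\<^sup>2" if "u \<in> units" for u
    proof -
      have "re (cj u * (b + p *\<^sub>R z)) = p * (\<zeta> u + re (cj u * b) / p)"
        using p z[OF that] by (simp add: distrib_left re_add re_scaleR)
      then show ?thesis
        using p by (simp add: power2_eq_square)
    qed
    then show ?thesis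
      unfolding parseval by (simp add: sum_divide_distrib sum_distrib_left)
  qed
  finally show ?thesis
    by (simp add: z_def b_def)
qed

section \<open>Iterated elimination and products of pivots\<close>

primrec pivots :: "'m::finite list \<Rightarrow> 'f ^ 'm ^ 'm \<Rightarrow> real" where
  "pivots [] M = 1"
| "pivots (k # ks) M = re (M $ k $ k) * pivots ks (eliminate k M)"

lemma pivots_snoc: "pivots (ks @ [k]) M = pivots ks M * re (fold eliminate ks M $ k $ k)"
  by (induction ks arbitrary: M) simp_all

lemma posdef_fold_eliminate: "posdef M \<Longrightarrow> posdef (fold eliminate ks M)"
  by (induction ks arbitrary: M) (simp_all add: posdef_eliminate)

lemma pivots_pos: "posdef M \<Longrightarrow> 0 < pivots ks M"
  by (induction ks arbitrary: M) (simp_all add: posdef_pivot posdef_eliminate)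

text \<open>Once row and column \<open>i\<close> are those of the identity, eliminating another
  index leaves them so, since the product subtracted there is zero. The second alternative of the
  hypothesis carries this through the induction.\<close>

lemma fold_eliminate_unit:
  assumes "posdef M" "i \<in> set ks \<or> (\<forall>j. M $ i $ j = (if i = j then 1 else 0) \<and> M $ j $ i = (if i
      = j then 1 else 0))"
  shows "fold eliminate ks M $ i $ j = (if i = j then 1 else 0)"
  using assms
proof (induction ks arbitrary: M)
  case (Cons k ks)
  have nz: "M $ k $ k \<noteq> 0"
    by (rule posdef_pivot_nz[OF Cons.prems(1)])
  have "i \<in> set ks \<or> (\<forall>j. eliminate k M $ i $ j = (if i = j then 1 else 0)
      \<and> eliminate k M $ j $ i = (if i = j then 1 else 0))"
  proof (cases "i \<in> set ks \<or> i = k")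
    case True
    then show ?thesis
      using eliminate_row_col[of M k, OF nz] by auto
  next
    case False
    then show ?thesis
      using Cons.prems(2) by (auto simp: eliminate_def)
  qed
  then show ?case
    using Cons.IH[OF posdef_eliminate[OF Cons.prems(1)]] by simp
qed auto

text \<open>Eliminating every index ends in the identity matrix, so a functional with the pivot rule
  and value \<open>1\<close> there is the product of pivots. It is applied to \<open>det\<close> and
  to \<open>moore_det\<close>.\<close>

lemma pivots_eq:
  fixes \<delta> :: "'f ^ 'm::finite ^ 'm \<Rightarrow> 'c::{comm_ring_1, real_algebra_1}"
  assumes "posdef M" "set ks = UNIV" and \<delta>1: "\<delta> (mat 1) = 1"
    and step: "\<And>M k. posdef M \<Longrightarrow> \<delta> M = of_real (re (M $ k $ k)) * \<delta> (eliminate k M)"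
  shows "\<delta> M = of_real (pivots ks M)"
proof -
  have "\<delta> M = of_real (pivots ks M) * \<delta> (fold eliminate ks M)"
    using \<open>posdef M\<close>
  proof (induction ks arbitrary: M)
    case (Cons k ks)
    show ?case
      using Cons.IH[OF posdef_eliminate[OF Cons.prems]] step[OF Cons.prems, of k]
          by (simp add: mult.assoc)
  qed simp
  moreover have "fold eliminate ks M = mat 1"
    using fold_eliminate_unit[OF \<open>posdef M\<close>] \<open>set ks = UNIV\<close> by (simp add: vec_eq_iff mat_def)
  ultimately show ?thesis
    using \<delta>1 by simp
qed

abbreviation (input) dim_units :: real where
  "dim_units \<equiv> real (card units)"

section \<open>Complete monotonicity of powers of pivot products\<close>

text \<open>Integrates the Gaussian over the coordinates in \<open>ks\<close>, in that order.
  Completing the square in coordinate \<open>k\<close> gives one real Gaussian for each unit, hence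
  the factor of the pivot to the power \<open>- dim_units / 2\<close>.\<close>

lemma completely_monotone_eliminate:
  fixes M :: "real ^ 'n \<Rightarrow> 'f ^ 'm::finite ^ 'm"
  assumes pd: "\<And>x. x \<in> pos_orthant \<Longrightarrow> posdef (M x)"
    and cm: "\<And>v. completely_monotone (\<lambda>x. exp (- form (M x) v))"
    and "distinct ks" "\<And>i. i \<in> set ks \<Longrightarrow> v $ i = 0"
  shows "completely_monotone (\<lambda>x. pivots ks (M x) powr (- dim_units / 2) *
    exp (- form (fold eliminate ks (M x)) v))"
  using assms(3,4)
proof (induction ks arbitrary: v rule: rev_induct)
  case Nil
  then show ?case by (simp add: cm)
next
  case (snoc k ks)
  let ?N = "\<lambda>x. fold eliminate ks (M x)"
  let ?p = "\<lambda>x. re (?N x $ k $ k)"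
  let ?w = "\<lambda>x. pivots ks (M x) powr (- dim_units / 2) * exp (- form (eliminate k (?N x)) v)"
  have pdN: "posdef (?N x)" if "x \<in> pos_orthant" for x
    using that by (intro posdef_fold_eliminate pd)
  have "completely_monotone (\<lambda>x. ?w x * ?p x powr (- dim_units / 2))"
  proof (rule completely_monotone_gaussian_marginals[where c
      = "\<lambda>u x. re (cj u * (?N x *v v) $ k) / ?p x"])
    show "0 < ?p x" if "x \<in> pos_orthant" for x
      using that by (intro posdef_pivot pdN)
    fix \<zeta> :: "'f \<Rightarrow> real"
    \<comment> \<open>The induction hypothesis is used at a vector with an arbitrary entry at
      \<open>k\<close>; distinctness keeps its entries in \<open>ks\<close> zero.\<close>
    have "completely_monotone (\<lambda>x. pivots ks (M x) powr (- dim_units / 2) *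
        exp (- form (?N x) (v + axis k (\<Sum>u\<in>units. \<zeta> u *\<^sub>R u))))"
      using snoc.prems by (intro snoc.IH) (auto simp: axis_def)
    then show "completely_monotone (\<lambda>x. ?w x *
        exp (- (?p x * (\<Sum>u\<in>units. (\<zeta> u + re (cj u * (?N x *v v) $ k) / ?p x)\<^sup>2))))"
    proof (rule completely_monotone_cong)
      fix x :: "real ^ 'n" assume x: "x \<in> pos_orthant"
      have "v $ k = 0" using snoc.prems by simp
      show "pivots ks (M x) powr (- dim_units / 2) *
          exp (- form (?N x) (v + axis k (\<Sum>u\<in>units. \<zeta> u *\<^sub>R u))) = ?w x *
          exp (- (?p x * (\<Sum>u\<in>units. (\<zeta> u + re (cj u * (?N x *v v) $ k) / ?p x)\<^sup>2)))"
        unfolding form_complete_square[where v = v and k = k, OF pdN[OF x] \<open>v $ k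
            = 0\<close>] minus_add_distrib exp_add
        by (simp only: mult.assoc)
    qed
  qed (rule finite_units)
  then show ?case
  proof (rule completely_monotone_cong)
    fix x :: "real ^ 'n" assume x: "x \<in> pos_orthant"
    show "?w x * ?p x powr (- dim_units / 2) =
        pivots (ks @ [k]) (M x) powr (- dim_units / 2)
            * exp (- form (fold eliminate (ks @ [k]) (M x)) v)"
      using pivots_pos[OF pd[OF x], of ks] posdef_pivot[OF pdN[OF x], of k]
      by (simp add: pivots_snoc powr_mult)
  qed
qed

text \<open>Each pivot before the last raises the lower bound by \<open>dim_units / 2\<close>, while
  the last one takes any nonnegative exponent through the gamma mixture; hence the length minus one.
  The induction hypothesis for \<open>\<beta> - dim_units / 2\<close> restores the missing power of
  the earlier pivots.\<close>

lemma completely_monotone_pivots: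
  fixes M :: "real ^ 'n \<Rightarrow> 'f ^ 'm::finite ^ 'm"
  assumes pd: "\<And>x. x \<in> pos_orthant \<Longrightarrow> posdef (M x)"
    and cm: "\<And>v. completely_monotone (\<lambda>x. exp (- form (M x) v))"
    and "distinct ks" and "ks = [] \<or> (real (length ks) - 1) * dim_units / 2 \<le> \<beta>"
  shows "completely_monotone (\<lambda>x. pivots ks (M x) powr (- \<beta>))"
  using assms(3,4)
proof (induction ks arbitrary: \<beta> rule: rev_induct)
  case Nil
  show ?case by (simp add: completely_monotone_const)
next
  case (snoc k ks)
  let ?N = "\<lambda>x. fold eliminate ks (M x)"
  let ?p = "\<lambda>x. re (?N x $ k $ k)"
  have p: "0 < ?p x" if "x \<in> pos_orthant" for x
    by (intro posdef_pivot posdef_fold_eliminate pd that)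
  have \<beta>: "real (length ks) * dim_units / 2 \<le> \<beta>"
    using snoc.prems by simp
  have "0 \<le> real (length ks) * dim_units / 2"
    by simp
  with \<beta> have "0 \<le> \<beta>"
    by linarith
  have "completely_monotone (\<lambda>x. pivots ks (M x) powr (- dim_units / 2) * ?p x powr (- \<beta>))"
  proof (rule completely_monotone_gamma_mixture[OF p \<open>0 \<le> \<beta>\<close>])
    fix t :: real assume "0 \<le> t"
    \<comment> \<open>The vector has \<open>sqrt t\<close> at \<open>k\<close> and zeros elsewhere,
      so its form is \<open>t\<close> times the next pivot.\<close>
    have "completely_monotone (\<lambda>x. pivots ks (M x) powr (- dim_units / 2) *
        exp (- form (?N x) (axis k (of_real (sqrt t)))))"
      using snoc.prems by (intro completely_monotone_eliminate pd cm) (auto simp: axis_def)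
    moreover have "form N (axis k (of_real (sqrt t))) = t * re (N $ k $ k)" for N :: "'f ^ 'm ^ 'm"
    proof -
      have "re (cj (axis k (of_real (sqrt t)) $ i) * N $ i $ j * axis k (of_real (sqrt t)) $ j)
          = (if j = k then if i = k then t * re (N $ k $ k) else 0 else 0)" for i j
        using \<open>0 \<le> t\<close> by (simp add: axis_def re_mult_of_real flip: mult.assoc)
      then show ?thesis by (simp add: form_eq_sum)
    qed
    ultimately show "completely_monotone (\<lambda>x. pivots ks (M x) powr (- dim_units / 2) * exp (- (t
        * ?p x)))"
      by simp
  qed
  moreover have "completely_monotone (\<lambda>x. pivots ks (M x) powr (- (\<beta> - dim_units / 2)))"
    using snoc.prems by (intro snoc.IH) (auto simp: field_simps)
  ultimately have "completely_monotone (\<lambda>x. pivots ks (M x) powr (- dim_units / 2)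
      * ?p x powr (- \<beta>) *
      pivots ks (M x) powr (- (\<beta> - dim_units / 2)))"
    by (rule completely_monotone_mult)
  then show ?case
  proof (rule completely_monotone_cong)
    fix x :: "real ^ 'n" assume x: "x \<in> pos_orthant"
    have "pivots ks (M x) powr (- dim_units / 2) * pivots ks (M x) powr (- (\<beta> - dim_units / 2))
        = pivots ks (M x) powr (- \<beta>)"
      by (simp flip: powr_add)
    then show "pivots ks (M x) powr (- dim_units / 2) * ?p x powr (- \<beta>) *
        pivots ks (M x) powr (- (\<beta> - dim_units / 2)) = pivots (ks @ [k]) (M x) powr (- \<beta>)"
      using pivots_pos[OF pd[OF x], of ks] p[OF x]
      by (simp add: pivots_snoc powr_mult mult_ac)
  qed
qed

section \<open>Positive definiteness from a trivial common kernel\<close>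

lemma form_add:
  assumes "hermitian A"
  shows "form A (v + t *\<^sub>R w)
      = form A v + 2 * t * re (\<Sum>i\<in>UNIV. cj (w $ i) * (A *v v) $ i) + t\<^sup>2 * form A w"
proof -
  have "re (cj (v $ i) * A $ i $ j * w $ j) = re (cj (w $ j) * A $ j $ i * v $ i)" for i j
    using re_cj[of "cj (v $ i) * A $ i $ j * w $ j"] assms
    by (simp add: cj_mult hermitian_def mult.assoc)
  then have sym: "(\<Sum>i\<in>UNIV. \<Sum>j\<in>UNIV. re (cj (v $ i) * A $ i $ j * w $ j))
      = (\<Sum>i\<in>UNIV. \<Sum>j\<in>UNIV. re (cj (w $ i) * A $ i $ j * v $ j))"
    by (subst sum.swap) simp
  have "re (cj ((v + t *\<^sub>R w) $ i) * A $ i $ j * (v + t *\<^sub>R w) $ j)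
      = re (cj (v $ i) * A $ i $ j * v $ j)
      + t * re (cj (v $ i) * A $ i $ j * w $ j) + t * re (cj (w $ i) * A $ i $ j * v $ j)
      + t\<^sup>2 * re (cj (w $ i) * A $ i $ j * w $ j)" for i j
    by (simp add: cj_add cj_scaleR distrib_left distrib_right re_add re_scaleR power2_eq_square)
  then have expand: "form A (v + t *\<^sub>R w) = form A v
      + t * (\<Sum>i\<in>UNIV. \<Sum>j\<in>UNIV. re (cj (v $ i) * A $ i $ j * w $ j))
      + t * (\<Sum>i\<in>UNIV. \<Sum>j\<in>UNIV. re (cj (w $ i) * A $ i $ j * v $ j)) + t\<^sup>2 * form A w"
    unfolding form_eq_sum by (simp add: sum.distrib sum_distrib_left)
  have mixed: "re (\<Sum>i\<in>UNIV. cj (w $ i) * (A *v v) $ i)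
      = (\<Sum>i\<in>UNIV. \<Sum>j\<in>UNIV. re (cj (w $ i) * A $ i $ j * v $ j))"
    by (simp add: matrix_vector_mult_def re_sum sum_distrib_left mult.assoc)
  have "a = b + 2 * t * z + q" if "a = b + t * x + t * y + q" "z = y" "x
      = y" for a b x y z q :: real
    using that by simp
  from this[OF expand mixed sym] show ?thesis .
qed

text \<open>In the direction \<open>w = A *v v\<close> the form is
  \<open>2 * t * N + t\<^sup>2 * c\<close>, where \<open>N\<close> is the squared length of
  \<open>w\<close>. Nonnegativity for small negative \<open>t\<close> forces
  \<open>N = 0\<close>.\<close>

lemma psd_kernel:
  assumes herm: "hermitian A" and psd: "\<And>v. 0 \<le> form A v" and "form A v = 0"
  shows "A *v v = 0"
proof -
  define w where "w = A *v v"
  define N where "N = (\<Sum>i\<in>UNIV. re (cj (w $ i) * w $ i))"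
  define c where "c = form A w"
  have "0 \<le> N" "0 \<le> c"
    using re_self_nonneg psd by (auto simp: N_def c_def sum_nonneg)
  have *: "0 \<le> 2 * t * N + t\<^sup>2 * c" for t
    using psd[of "v + t *\<^sub>R w"] \<open>form A v = 0\<close>
    by (simp add: form_add[OF herm] N_def c_def w_def re_sum)
  \<comment> \<open>The time \<open>t = - r\<close> makes the quadratic equal to
    \<open>- (r\<^sup>2 * (c + 2))\<close>; the added \<open>1\<close> keeps the denominator
    positive.\<close>
  define r where "r = N / (c + 1)"
  have N: "N = r * (c + 1)"
    using \<open>0 \<le> c\<close> by (simp add: r_def)
  have "0 \<le> 2 * - r * N + (- r)\<^sup>2 * c"
    by (rule *)
  also have "\<dots> = - (r\<^sup>2 * (c + 2))"
    by (simp add: N algebra_simps power2_eq_square)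
  finally have "r\<^sup>2 * (c + 2) \<le> 0" by simp
  with \<open>0 \<le> c\<close> have "r = 0"
    by (simp add: mult_le_0_iff)
  with N have "N = 0" by simp
  then have "\<forall>i\<in>UNIV. re (cj (w $ i) * w $ i) = 0"
    unfolding N_def by (subst sum_nonneg_eq_0_iff[symmetric]) (simp_all add: re_self_nonneg)
  then show ?thesis
    by (simp add: w_def[symmetric] re_self_eq_0_iff vec_eq_iff)
qed

text \<open>A sum of nonnegative forms with positive weights vanishes only if each of them does, and
  then \<open>psd_kernel\<close> puts \<open>v\<close> into the common kernel.\<close>

lemma posdef_sum:
  fixes A :: "'n::finite \<Rightarrow> 'f ^ 'm::finite ^ 'm"
  assumes herm: "\<And>i. hermitian (A i)" and psd: "\<And>i v. 0 \<le> form (A i) v"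
    and ker: "\<And>v. (\<And>i. A i *v v = 0) \<Longrightarrow> v = 0"
    and x: "x \<in> pos_orthant"
  shows "posdef (\<Sum>i\<in>UNIV. x $ i *\<^sub>R A i)"
  unfolding posdef_def
proof (intro conjI allI impI)
  show "hermitian (\<Sum>i\<in>UNIV. x $ i *\<^sub>R A i)"
    using herm by (simp add: hermitian_def sum_component cj_sum cj_scaleR)
  fix v :: "'f ^ 'm" assume "v \<noteq> 0"
  have nonneg: "0 \<le> x $ i * form (A i) v" for i
    using x psd by (intro mult_nonneg_nonneg) (auto simp: pos_orthant_def less_imp_le)
  have "form (\<Sum>i\<in>UNIV. x $ i *\<^sub>R A i) v \<noteq> 0"
  proof
    assume "form (\<Sum>i\<in>UNIV. x $ i *\<^sub>R A i) v = 0"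
    then have "x $ i * form (A i) v = 0" for i
      unfolding form_scaleR_sum using nonneg by (subst (asm) sum_nonneg_eq_0_iff) auto
    then have "form (A i) v = 0" for i
      using x unfolding pos_orthant_def mem_Collect_eq by (metis less_irrefl mult_eq_0_iff)
    then have "A i *v v = 0" for i
      by (intro psd_kernel herm psd)
    then show False
      using ker \<open>v \<noteq> 0\<close> by blast
  qed
  moreover have "0 \<le> form (\<Sum>i\<in>UNIV. x $ i *\<^sub>R A i) v"
    unfolding form_scaleR_sum by (intro sum_nonneg nonneg)
  ultimately show "0 < form (\<Sum>i\<in>UNIV. x $ i *\<^sub>R A i) v"
    by simp
qed

text \<open>\<open>P\<close> is the product of pivots along an arbitrary enumeration of the indices.
  The multiples of \<open>dim_units / 2\<close> are powers of the case of full elimination; the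
  remaining range is \<open>completely_monotone_pivots\<close>. The function \<open>\<delta>\<close>
  may be complex-valued, so the statement supplies a real \<open>P\<close> that represents it on the
  orthant.\<close>

theorem completely_monotone_det:
  fixes A :: "'n::finite \<Rightarrow> 'f ^ 'm::finite ^ 'm" and \<delta> ::
      "'f ^ 'm ^ 'm \<Rightarrow> 'c::{comm_ring_1, real_algebra_1}"
  assumes herm: "\<And>i. hermitian (A i)" and psd: "\<And>i v. 0 \<le> form (A i) v"
    and ker: "\<And>v. (\<And>i. A i *v v = 0) \<Longrightarrow> v = 0"
    and \<delta>1: "\<delta> (mat 1) = 1"
    and step: "\<And>M k. posdef M \<Longrightarrow> \<delta> M = of_real (re (M $ k $ k)) * \<delta> (eliminate k M)"
  shows "\<exists>P. (\<forall>x\<in>pos_orthant. \<delta> (\<Sum>i\<in>UNIV. x $ i *\<^sub>R A i) = of_real (P x) \<and> 0 < P x) \<and>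
    (\<forall>\<beta>. (\<exists>k. \<beta> = real k * dim_units / 2) \<or> (real CARD('m) - 1) * dim_units / 2 \<le> \<beta> \<longrightarrow>
      completely_monotone (\<lambda>x. P x powr (- \<beta>)))"
proof -
  define M where "M x = (\<Sum>i\<in>UNIV. x $ i *\<^sub>R A i)" for x :: "real ^ 'n"
  obtain ks :: "'m list" where ks: "distinct ks" "set ks = UNIV"
    using finite_distinct_list[of "UNIV :: 'm set"] by auto
  then have len: "length ks = CARD('m)"
    by (metis distinct_card)
  define P where "P x = pivots ks (M x)" for x
  have pd: "posdef (M x)" if "x \<in> pos_orthant" for x
    unfolding M_def by (rule posdef_sum[OF herm psd _ that]) (rule ker)
  have P_pos: "0 < P x" if "x \<in> pos_orthant" for x
    unfolding P_def by (rule pivots_pos[OF pd[OF that]])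
  have cm: "completely_monotone (\<lambda>x. exp (- form (M x) v))" for v
    unfolding M_def form_scaleR_sum by (rule completely_monotone_exp) (rule psd)
  \<comment> \<open>At \<open>v = 0\<close> the exponential factor is \<open>1\<close>, and only the
    power of the pivots remains.\<close>
  have half: "completely_monotone (\<lambda>x. P x powr (- dim_units / 2))"
    using completely_monotone_eliminate[OF pd cm ks(1), of 0]
    by (simp add: P_def form_def)
  show ?thesis
  proof (intro exI[of _ P] conjI ballI allI impI)
    show "\<delta> (\<Sum>i\<in>UNIV. x $ i *\<^sub>R A i) = of_real (P x)" if "x \<in> pos_orthant" for x
      using pivots_eq[OF pd[OF that] ks(2), of \<delta>, OF \<delta>1 step] by (simp add: P_def M_def)
    fix \<beta> assume "(\<exists>k. \<beta> = real k * dim_units / 2) \<or> (real CARD('m) - 1) * dim_units / 2 \<le> \<beta>"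
    then show "completely_monotone (\<lambda>x. P x powr (- \<beta>))"
    proof
      assume "\<exists>k. \<beta> = real k * dim_units / 2"
      then obtain k where k: "\<beta> = real k * dim_units / 2" ..
      show ?thesis
      proof (rule completely_monotone_cong[OF completely_monotone_power[OF half, of k]])
        fix x :: "real ^ 'n" assume "x \<in> pos_orthant"
        then show "(P x powr (- dim_units / 2)) ^ k = P x powr (- \<beta>)"
          using P_pos[of x] by (simp add: k powr_powr mult.commute flip: powr_realpow)
      qed
    next
      assume "(real CARD('m) - 1) * dim_units / 2 \<le> \<beta>"
      then show ?thesis
        unfolding P_def by (intro completely_monotone_pivots[OF pd cm ks(1)]) (simp_all add: len)
    qed
  qed (rule P_pos)
qed

end

section \<open>Real, complex and quaternionic matrices\<close>

interpretation real_conj: real_conjugation id id "{1 :: real}"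
  by standard (simp_all add: power2_eq_square)

interpretation complex_conj: real_conjugation cnj Re "{1, \<i>}"
proof
  show "Re (cnj u * v) = (if u = v then 1 else 0)" if "u \<in> {1, \<i>}" "v \<in> {1, \<i>}" for u v
    using that by auto
qed (simp_all add: complex_eq_iff power2_eq_square)

interpretation quat_conj: real_conjugation qcnj qRe
    "{Quat 1 0 0 0, Quat 0 1 0 0, Quat 0 0 1 0, Quat 0 0 0 1}"
proof
  fix x y u v :: quat and r :: real
  show "qcnj (x + y) = qcnj x + qcnj y" "qcnj (qcnj x) = x" "qcnj (of_real r) = of_real r"
    unfolding quat_eq_iff by simp_all
  show "qcnj (x * y) = qcnj y * qcnj x"
    unfolding quat_eq_iff by (simp add: algebra_simps)
  show "qRe (x + y) = qRe x + qRe y" "qRe (r *\<^sub>R x) = r * qRe x" "qRe 1 = 1" "qRe (qcnj x) = qRe x"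
    by simp_all
  show "of_real (qRe x) = x" if "qcnj x = x"
    using that unfolding quat_eq_iff by simp
  show "finite {Quat 1 0 0 0, Quat 0 1 0 0, Quat 0 0 1 0, Quat 0 0 0 1}"
    by simp
  show "qRe (qcnj x * x)
      = (\<Sum>u\<in>{Quat 1 0 0 0, Quat 0 1 0 0, Quat 0 0 1 0, Quat 0 0 0 1}. (qRe (qcnj u * x))\<^sup>2)"
    by (simp add: power2_eq_square)
  show "qRe (qcnj u * v) = (if u = v then 1 else 0)"
    if "u \<in> {Quat 1 0 0 0, Quat 0 1 0 0, Quat 0 0 1 0, Quat 0 0 0 1}"
      "v \<in> {Quat 1 0 0 0, Quat 0 1 0 0, Quat 0 0 1 0, Quat 0 0 0 1}"
    using that by (elim insertE emptyE) simp_all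
qed

section \<open>Full rank and trivial kernels\<close>

lemma full_rank_kernel:
  fixes A :: "'a::field ^ 'n::finite ^ 'n"
  assumes "rank A = CARD('n)" "A *v v = 0"
  shows "v = 0"
proof -
  have "vec.span (rows A) = UNIV"
    using assms(1) unfolding row_rank_def_gen
    by (simp add: vec.dim_eq_full[symmetric] card_cart_basis vec.dimension_def)
  then show ?thesis
    using assms(2) matrix_left_invertible_span_rows_gen[of A] matrix_left_invertible_ker[of A] by
        blast
qed

text \<open>For hermitian \<open>M\<close>, conjugating \<open>M *v v = 0\<close> gives a
  left-linear relation among the rows with coefficients \<open>qcnj (v $ i)\<close>. Full left row
  rank makes all rows left-independent, so these coefficients vanish.\<close>

lemma full_quat_rank_kernel:
  fixes M :: "quat ^ 'm::finite ^ 'm"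
  assumes rank: "quat_rank M = CARD('m)" and adj: "quat_adjoint M = M" and v: "M *v v = 0"
  shows "v = 0"
proof -
  let ?S = "{card I |I. rows_left_independent M I}"
  have "finite ?S"
    by (rule finite_subset[of _ "{..CARD('m)}"]) (auto simp: card_mono)
  \<comment> \<open>A nonempty finite set attains its \<open>Max\<close>, so some independent set of
    rows has full cardinality.\<close>
  moreover have "card {} \<in> ?S"
    by (intro CollectI exI[of _ "{}"]) (simp add: rows_left_independent_def)
  ultimately have "CARD('m) \<in> ?S"
    using rank unfolding quat_rank_def by (metis (no_types, lifting) Max_in empty_iff)
  then obtain I where I: "rows_left_independent M I" "card I = CARD('m)"
    by auto
  then have "I = UNIV"
    by (simp add: card_eq_UNIV_imp_eq_UNIV)
  have "(\<Sum>i\<in>UNIV. qcnj (v $ i) *s row i M) = 0"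
  proof -
    have "(\<Sum>i\<in>UNIV. qcnj (v $ i) * M $ i $ j) = 0" for j
    proof -
      have M: "M $ i $ j = qcnj (M $ j $ i)" for i
        using arg_cong[OF adj, of "\<lambda>N. N $ i $ j"] by (simp add: quat_adjoint_def)
      have "(\<Sum>i\<in>UNIV. qcnj (v $ i) * M $ i $ j) = qcnj ((M *v v) $ j)"
        unfolding M by (simp add: matrix_vector_mult_def quat_conj.cj_sum quat_conj.cj_mult)
      then show ?thesis using v by simp
    qed
    then show ?thesis
      by (simp add: vec_eq_iff row_def sum_component)
  qed
  then have "qcnj (v $ i) = 0" for i
    using I(1) unfolding rows_left_independent_def \<open>I = UNIV\<close>
    by (elim allE[of _ "\<lambda>i. qcnj (v $ i)"]) simp
  then have "v $ i = 0" for i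
    using quat_conj.cj_cj[of "v $ i"] by simp
  then show ?thesis by (simp add: vec_eq_iff)
qed

lemma matrix_scaleR_sum_vector:
  fixes A :: "'n::finite \<Rightarrow> 'a::real_algebra_1 ^ 'm::finite ^ 'm"
  shows "(\<Sum>i\<in>UNIV. c i *\<^sub>R A i) *v v = (\<Sum>i\<in>UNIV. c i *\<^sub>R (A i *v v))"
proof -
  have "((\<Sum>i\<in>UNIV. c i *\<^sub>R A i) *v v) $ j = (\<Sum>i\<in>UNIV. c i *\<^sub>R (A i *v v)) $ j" for j
  proof -
    have "((\<Sum>i\<in>UNIV. c i *\<^sub>R A i) *v v) $ j = (\<Sum>k\<in>UNIV. \<Sum>i\<in>UNIV. c i *\<^sub>R (A i $ j $ k * v $ k))"
      by (simp add: matrix_vector_mult_def sum_component sum_distrib_right)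
    also have "\<dots> = (\<Sum>i\<in>UNIV. \<Sum>k\<in>UNIV. c i *\<^sub>R (A i $ j $ k * v $ k))"
      by (rule sum.swap)
    finally show ?thesis
      by (simp add: matrix_vector_mult_def sum_component scaleR_sum_right)
  qed
  then show ?thesis by (simp add: vec_eq_iff)
qed

section \<open>The three kinds of scalars\<close>

lemma real_det_completely_monotone:
  fixes A :: "'n::finite \<Rightarrow> real ^ 'm::finite ^ 'm"
  assumes psd: "\<And>i. real_psd (A i)" and rank: "rank (\<Sum>i\<in>UNIV. c i *\<^sub>R A i) = CARD('m)"
  defines "P \<equiv> \<lambda>x :: real ^ 'n. det (\<Sum>i\<in>UNIV. x $ i *\<^sub>R A i)"
  shows "\<And>x. x \<in> pos_orthant \<Longrightarrow> 0 < P x"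
    and "\<And>\<beta>. (\<exists>k. \<beta> = real k / 2) \<or> (real CARD('m) - 1) / 2 \<le> \<beta> \<Longrightarrow>
      completely_monotone (\<lambda>x. P x powr (- \<beta>))"
proof -
  have herm: "real_conj.hermitian (A i)" for i
  proof -
    have "transpose (A i) $ a $ b = A i $ a $ b" for a b
      using psd[of i] by (simp add: real_psd_def)
    then show ?thesis
      by (simp add: real_conj.hermitian_def transpose_def)
  qed
  have psd_form: "0 \<le> real_conj.form (A i) v" for i v
    using psd[of i] by (simp add: real_psd_def real_conj.form_def inner_vec_def)
  \<comment> \<open>A vector in every kernel is killed by every linear combination, in particular by
    the one of full rank.\<close>
  have ker: "v = 0" if "\<And>i. A i *v v = 0" for v
    using full_rank_kernel[OF rank, of v] that by (simp add: matrix_scaleR_sum_vector)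
  have step: "det M = of_real (id (M $ k $ k)) * det (eliminate k M)" if "real_conj.posdef M"
      for M :: "real ^ 'm ^ 'm" and k
    using det_eliminate[OF real_conj.posdef_pivot_nz[OF that], of k] by simp
  obtain p where p:
    "\<And>x :: real ^ 'n. x \<in> pos_orthant \<Longrightarrow> det (\<Sum>i\<in>UNIV. x $ i *\<^sub>R A i) = of_real (p x)"
    "\<And>x :: real ^ 'n. x \<in> pos_orthant \<Longrightarrow> 0 < p x"
    "\<And>\<beta>. (\<exists>k. \<beta>
        = real k * real (card {1 :: real}) / 2) \<or> (real CARD('m) - 1)
            * real (card {1 :: real}) / 2 \<le> \<beta> \<Longrightarrow>
      completely_monotone (\<lambda>x. p x powr (- \<beta>))"
    using real_conj.completely_monotone_det[of A det, OF herm psd_form ker det_I step] by blast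
  show "0 < P x" if "x \<in> pos_orthant" for x
    using p(1,2)[OF that] by (simp add: P_def)
  show "completely_monotone (\<lambda>x. P x powr (- \<beta>))"
    if "(\<exists>k. \<beta> = real k / 2) \<or> (real CARD('m) - 1) / 2 \<le> \<beta>" for \<beta>
  proof (rule completely_monotone_cong)
    show "completely_monotone (\<lambda>x. p x powr (- \<beta>))"
      using that by (intro p(3)) auto
  qed (simp add: P_def p(1))
qed

lemma complex_det_completely_monotone:
  fixes A :: "'n::finite \<Rightarrow> complex ^ 'm::finite ^ 'm"
  assumes psd: "\<And>i. complex_psd (A i)" and rank: "rank (\<chi> j k. \<Sum>i\<in>UNIV. c i * A i $ j $ k)
      = CARD('m)"
  defines "P \<equiv> \<lambda>x :: real ^ 'n. det (\<Sum>i\<in>UNIV. x $ i *\<^sub>R A i)"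
  shows "\<And>x. x \<in> pos_orthant \<Longrightarrow> P x \<in> \<real> \<and> 0 < Re (P x)"
    and "\<And>\<beta>. (\<exists>k. \<beta> = real k) \<or> real CARD('m) - 1 \<le> \<beta> \<Longrightarrow>
      completely_monotone (\<lambda>x. Re (P x) powr (- \<beta>))"
proof -
  have herm: "complex_conj.hermitian (A i)" for i
  proof -
    have "(\<chi> a b. cnj (A i $ b $ a)) $ a $ b = A i $ a $ b" for a b
      using psd[of i] by (simp only: complex_psd_def)
    then show ?thesis
      by (simp add: complex_conj.hermitian_def)
  qed
  have psd_form: "0 \<le> complex_conj.form (A i) v" for i v
    using psd[of i] unfolding complex_psd_def complex_conj.form_def
    by (simp add: complex_nonneg_Reals_iff)
  \<comment> \<open>The combination of full rank has complex coefficients here; it still annihilates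
    the common kernel, which is all that is required of it.\<close>
  have ker: "v = 0" if "\<And>i. A i *v v = 0" for v
  proof (rule full_rank_kernel[OF rank])
    have "((\<chi> j k. \<Sum>i\<in>UNIV. c i * A i $ j $ k) *v v) $ j = (\<Sum>i\<in>UNIV. c i * (A i *v v) $ j)" for j
    proof -
      have "((\<chi> j k. \<Sum>i\<in>UNIV. c i * A i $ j $ k) *v v) $ j
          = (\<Sum>k\<in>UNIV. \<Sum>i\<in>UNIV. c i * (A i $ j $ k * v $ k))"
        by (simp add: matrix_vector_mult_def sum_distrib_right mult.assoc)
      also have "\<dots> = (\<Sum>i\<in>UNIV. \<Sum>k\<in>UNIV. c i * (A i $ j $ k * v $ k))"
        by (rule sum.swap)
      finally show ?thesis
        by (simp add: matrix_vector_mult_def sum_distrib_left)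
    qed
    then show "(\<chi> j k. \<Sum>i\<in>UNIV. c i * A i $ j $ k) *v v = 0"
      using that by (simp add: vec_eq_iff)
  qed
  have step: "det M = of_real (Re (M $ k $ k)) * det (eliminate k M)" if "complex_conj.posdef M"
      for M :: "complex ^ 'm ^ 'm" and k
  proof -
    have "complex_conj.hermitian M" using that by (simp add: complex_conj.posdef_def)
    from complex_conj.hermitian_diag[OF this, of k] show ?thesis
      using det_eliminate[OF complex_conj.posdef_pivot_nz[OF that], of k] by metis
  qed
  obtain p where p:
    "\<And>x :: real ^ 'n. x \<in> pos_orthant \<Longrightarrow> det (\<Sum>i\<in>UNIV. x $ i *\<^sub>R A i) = of_real (p x)"
    "\<And>x :: real ^ 'n. x \<in> pos_orthant \<Longrightarrow> 0 < p x"
    "\<And>\<beta>. (\<exists>k. \<beta>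
        = real k * real (card {1, \<i>}) / 2) \<or> (real CARD('m) - 1) * real (card {1, \<i>}) / 2 \<le> \<beta> \<Longrightarrow>
      completely_monotone (\<lambda>x. p x powr (- \<beta>))"
    using complex_conj.completely_monotone_det[of A det, OF herm psd_form ker det_I step] by blast
  show "P x \<in> \<real> \<and> 0 < Re (P x)" if "x \<in> pos_orthant" for x
    using p(1,2)[OF that] by (simp add: P_def)
  show "completely_monotone (\<lambda>x. Re (P x) powr (- \<beta>))"
    if "(\<exists>k. \<beta> = real k) \<or> real CARD('m) - 1 \<le> \<beta>" for \<beta>
  proof (rule completely_monotone_cong)
    show "completely_monotone (\<lambda>x. p x powr (- \<beta>))"
      using that by (intro p(3)) auto
  qed (simp add: P_def p(1))
qed

text \<open>There are four units, so half the real dimension is \<open>2\<close>: this gives the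
  even integers and the bound \<open>2 * (m - 1)\<close> with \<open>m = CARD('m)\<close>.\<close>

lemma moore_det_completely_monotone:
  fixes A :: "'n::finite \<Rightarrow> quat ^ 'm::finite ^ 'm"
  assumes psd: "\<And>i. quat_psd (A i)" and rank: "quat_rank (\<Sum>i\<in>UNIV. c i *\<^sub>R A i) = CARD('m)"
  defines "P \<equiv> \<lambda>x :: real ^ 'n. moore_det (\<Sum>i\<in>UNIV. x $ i *\<^sub>R A i)"
  shows "\<And>x. x \<in> pos_orthant \<Longrightarrow> P x \<in> \<real> \<and> 0 < Re (P x)"
    and "\<And>\<beta>. (\<exists>k. \<beta> = 2 * real k) \<or> 2 * real CARD('m) - 2 \<le> \<beta> \<Longrightarrow>
      completely_monotone (\<lambda>x. Re (P x) powr (- \<beta>))"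
proof -
  have herm: "quat_conj.hermitian (A i)" for i
  proof -
    have "(\<chi> a b. qcnj (A i $ b $ a)) $ a $ b = A i $ a $ b" for a b
      using psd[of i] by (simp only: quat_psd_def)
    then show ?thesis
      by (simp add: quat_conj.hermitian_def)
  qed
  have psd_form: "0 \<le> quat_conj.form (A i) v" for i v
  proof -
    have "(\<Sum>j\<in>UNIV. qcnj (v $ j) * (A i *v v) $ j) \<in> \<real>\<^sub>\<ge>\<^sub>0"
      using psd[of i] unfolding quat_psd_def by blast
    then show ?thesis
      by (auto simp: quat_conj.form_def nonneg_Reals_def)
  qed
  have ker: "v = 0" if "\<And>i. A i *v v = 0" for v
  proof (rule full_quat_rank_kernel[OF rank])
    show "quat_adjoint (\<Sum>i\<in>UNIV. c i *\<^sub>R A i) = (\<Sum>i\<in>UNIV. c i *\<^sub>R A i)"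
      using herm by (simp add: quat_adjoint_def vec_eq_iff sum_component quat_conj.cj_sum
          quat_conj.cj_scaleR quat_conj.hermitian_def)
    show "(\<Sum>i\<in>UNIV. c i *\<^sub>R A i) *v v = 0"
      using that by (simp add: matrix_scaleR_sum_vector)
  qed
  have step: "moore_det M
      = of_real (qRe (M $ k $ k)) * moore_det (eliminate k M)" if M: "quat_conj.posdef M"
          for M :: "quat ^ 'm ^ 'm" and k
  proof (rule moore_det_eliminate)
    have hM: "quat_conj.hermitian M" using M by (simp add: quat_conj.posdef_def)
    then show "qcnj (M $ j $ i) = M $ i $ j" for i j
      unfolding quat_conj.hermitian_def by blast
    show "qcnj (eliminate k M $ j $ i) = eliminate k M $ i $ j" for i j
      using quat_conj.hermitian_eliminate[OF hM, of k] unfolding quat_conj.hermitian_def by blast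
    show "M $ k $ k = of_real (qRe (M $ k $ k))"
      by (rule quat_conj.hermitian_diag[OF hM])
    show "0 < qRe (M $ k $ k)"
      by (rule quat_conj.posdef_pivot[OF M])
  qed
  obtain p where p:
    "\<And>x :: real ^ 'n. x \<in> pos_orthant \<Longrightarrow> moore_det (\<Sum>i\<in>UNIV. x $ i *\<^sub>R A i) = of_real (p x)"
    "\<And>x :: real ^ 'n. x \<in> pos_orthant \<Longrightarrow> 0 < p x"
    "\<And>\<beta>. (\<exists>k. \<beta>
        = real k * real (card {Quat 1 0 0 0, Quat 0 1 0 0, Quat 0 0 1 0, Quat 0 0 0 1}) / 2) \<or>
            (real CARD('m) - 1) * real
                (card {Quat 1 0 0 0, Quat 0 1 0 0, Quat 0 0 1 0, Quat 0 0 0 1}) / 2 \<le> \<beta> \<Longrightarrow>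
      completely_monotone (\<lambda>x. p x powr (- \<beta>))"
    using quat_conj.completely_monotone_det[of A moore_det,
        OF herm psd_form ker moore_det_mat_1 step] by blast
  show "P x \<in> \<real> \<and> 0 < Re (P x)" if "x \<in> pos_orthant" for x
    using p(1,2)[OF that] by (simp add: P_def)
  show "completely_monotone (\<lambda>x. Re (P x) powr (- \<beta>))"
    if "(\<exists>k. \<beta> = 2 * real k) \<or> 2 * real CARD('m) - 2 \<le> \<beta>" for \<beta>
  proof (rule completely_monotone_cong)
    show "completely_monotone (\<lambda>x. p x powr (- \<beta>))"
      using that by (intro p(3)) auto
  qed (simp add: P_def p(1))
qed

text \<open>Positivity on the orthant is asserted together with complete monotonicity so that
  \<open>powr\<close> is a genuine real power. In the complex and quaternionic cases the determinant
  has a complex type, so the statement also says that it is real and takes the power of its real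
  part.\<close>

theorem theorem1p2:
  fixes A :: "'n::finite \<Rightarrow> real ^ 'm::finite ^ 'm"
    and B :: "'n \<Rightarrow> complex ^ 'm ^ 'm"
    and C :: "'n \<Rightarrow> quat ^ 'm ^ 'm"
  shows
   "((\<forall>i. real_psd (A i)) \<and>
     (\<exists>c :: 'n \<Rightarrow> real. rank (\<Sum>i\<in>UNIV. c i *\<^sub>R A i) = CARD('m)) \<longrightarrow>
       (let P = (\<lambda>x :: real ^ 'n. det (\<Sum>i\<in>UNIV. x $ i *\<^sub>R A i))
        in (\<forall>x\<in>pos_orthant. 0 < P x) \<and>
           (\<forall>\<beta> :: real. (\<exists>k :: nat. \<beta> = real k / 2) \<or> (real CARD('m) - 1) / 2 \<le> \<beta> \<longrightarrow>
              completely_monotone (\<lambda>x. P x powr (- \<beta>)))))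
    \<and>
    ((\<forall>i. complex_psd (B i)) \<and>
     (\<exists>c :: 'n \<Rightarrow> complex. rank (\<chi> j k. \<Sum>i\<in>UNIV. c i * B i $ j $ k) = CARD('m)) \<longrightarrow>
       (let P = (\<lambda>x :: real ^ 'n. det (\<Sum>i\<in>UNIV. x $ i *\<^sub>R B i))
        in (\<forall>x\<in>pos_orthant. P x \<in> \<real> \<and> 0 < Re (P x)) \<and>
           (\<forall>\<beta> :: real. (\<exists>k :: nat. \<beta> = real k) \<or> real CARD('m) - 1 \<le> \<beta> \<longrightarrow>
              completely_monotone (\<lambda>x. Re (P x) powr (- \<beta>)))))
    \<and>
    ((\<forall>i. quat_psd (C i)) \<and>
     (\<exists>c :: 'n \<Rightarrow> real. quat_rank (\<Sum>i\<in>UNIV. c i *\<^sub>R C i) = CARD('m)) \<longrightarrow>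
       (let P = (\<lambda>x :: real ^ 'n. moore_det (\<Sum>i\<in>UNIV. x $ i *\<^sub>R C i))
        in (\<forall>x\<in>pos_orthant. P x \<in> \<real> \<and> 0 < Re (P x)) \<and>
           (\<forall>\<beta> :: real. (\<exists>k :: nat. \<beta> = 2 * real k) \<or> 2 * real CARD('m) - 2 \<le> \<beta> \<longrightarrow>
              completely_monotone (\<lambda>x. Re (P x) powr (- \<beta>)))))"
  using real_det_completely_monotone[of A] complex_det_completely_monotone[of B]
    moore_det_completely_monotone[of C]
  unfolding Let_def by blast

end
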